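(* Let $N = 2^n$. Any quantum algorithm with existential query access to an unknown string $x \in \{0,1\}^N$ which, with constant success probability, outputs an index $i$ with $x_i = 1$ (for every nonzero $x$) must make $\Omega(\log\log N) = \Omega(\log n)$ existential queries. This remains true even if the algorithm is additionally allowed to make $\mathrm{poly}(n)$ classical standard queries.
   Context: Existential query access to $x \in \{0,1\}^N$ means the algorithm may apply the unitary $O^{\exists}_x : \ket{z} \mapsto (-1)^{\mathrm{overlap}(x,z)}\ket{z}$ for $z \in \{0,1\}^N$, where $\mathrm{overlap}(x,z)=1$ if there exists $i$ with $x_i = z_i = 1$ and $0$ otherwise. A standard query is the unitary $O_x : \ket{i} \mapsto (-1)^{x_i}\ket{i}$ for $i \in [N]$; a classical standard query is an application of $O_x$ to a computational basis state. The algorithm's time and space are unrestricted; only the number of queries is counted. *)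

theory Defs imports Complex_Main begin

text \<open>Strings x in {0,1}^N (N = 2^n) are represented by their support X \<subseteq> {..<N};
 z in {0,1}^N likewise by a set Z. Quantum states are density matrices on the
 computational basis {..<d} of a d-dimensional workspace (d arbitrary).\<close>

definition overlap :: "nat set \<Rightarrow> nat set \<Rightarrow> bool" where
  "overlap X Z \<longleftrightarrow> X \<inter> Z \<noteq> {}"

text \<open>Steps of an algorithm:
 Unitary U: an arbitrary unitary d x d matrix (free, not counted);
 ExQuery zl: one existential query, O^ex_x tensor I, where zl w is the query-register
   content (a z in {0,1}^N) of basis state w; acts by phase (-1)^overlap(x, zl w);
 ClQuery il fl: one classical standard query: the index register il w is measured
   (dephased) and x_i is XOR-ed into a target bit; fl is the involution flipping the
   target bit (preserving il).\<close>

datatype step =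
    Unitary "nat \<Rightarrow> nat \<Rightarrow> complex"
  | ExQuery "nat \<Rightarrow> nat set"
  | ClQuery "nat \<Rightarrow> nat" "nat \<Rightarrow> nat"

definition is_unitary :: "nat \<Rightarrow> (nat \<Rightarrow> nat \<Rightarrow> complex) \<Rightarrow> bool" where
  "is_unitary d U \<longleftrightarrow>
     (\<forall>i<d. \<forall>j<d. (\<Sum>k<d. U i k * cnj (U j k)) = (if i = j then 1 else 0))"

fun step_ok :: "nat \<Rightarrow> nat \<Rightarrow> step \<Rightarrow> bool" where
  "step_ok n d (Unitary U) = is_unitary d U"
| "step_ok n d (ExQuery zl) = (\<forall>w<d. zl w \<subseteq> {..<2^n})"
| "step_ok n d (ClQuery il fl) =
     (\<forall>w<d. il w < 2^n \<and> fl w < d \<and> fl (fl w) = w \<and> il (fl w) = il w)"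

definition ex_sign :: "nat set \<Rightarrow> nat set \<Rightarrow> complex" where
  "ex_sign X Z = (if overlap X Z then -1 else 1)"

fun apply_step :: "nat set \<Rightarrow> nat \<Rightarrow> step \<Rightarrow> (nat \<Rightarrow> nat \<Rightarrow> complex) \<Rightarrow> (nat \<Rightarrow> nat \<Rightarrow> complex)" where
  "apply_step X d (Unitary U) \<rho> =
     (\<lambda>a b. \<Sum>k<d. \<Sum>l<d. U a k * \<rho> k l * cnj (U b l))"
| "apply_step X d (ExQuery zl) \<rho> =
     (\<lambda>a b. ex_sign X (zl a) * ex_sign X (zl b) * \<rho> a b)"
| "apply_step X d (ClQuery il fl) \<rho> =
     (let g = (\<lambda>w. if il w \<in> X then fl w else w)
      in (\<lambda>a b. if il a = il b then \<rho> (g a) (g b) else 0))"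

definition run :: "nat set \<Rightarrow> nat \<Rightarrow> step list \<Rightarrow> nat \<Rightarrow> (nat \<Rightarrow> nat \<Rightarrow> complex)" where
  "run X d ss w0 = fold (apply_step X d) ss (\<lambda>a b. if a = w0 \<and> b = w0 then 1 else 0)"

definition success_prob :: "nat set \<Rightarrow> nat \<Rightarrow> step list \<Rightarrow> nat \<Rightarrow> (nat \<Rightarrow> nat) \<Rightarrow> real" where
  "success_prob X d ss w0 ol = (\<Sum>w<d. if ol w \<in> X then Re (run X d ss w0 w w) else 0)"

definition num_ex :: "step list \<Rightarrow> nat" where
  "num_ex ss = length (filter (\<lambda>s. case s of ExQuery _ \<Rightarrow> True | _ \<Rightarrow> False) ss)"

definition num_cl :: "step list \<Rightarrow> nat" where
  "num_cl ss = length (filter (\<lambda>s. case s of ClQuery _ _ \<Rightarrow> True | _ \<Rightarrow> False) ss)"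

end

theory Submission
  imports Defs "HOL-Analysis.Convex" "HOL-Analysis.Harmonic_Numbers"
    "HOL-Real_Asymp.Real_Asymp" "Jordan_Normal_Form.Determinant"
begin

text \<open>
  Adversary argument with Hilbert-type weights. A hard input at scale \<open>a < n div 2\<close> is the set of
  \<open>2 ^ a\<close> uniform random indices, and an existential query is then essentially a threshold query:
  it reveals whether \<open>2 ^ a\<close> exceeds the inverse density of the queried set. Weight the overlap of the final
  states on independent inputs at scales \<open>a\<close>, \<open>b\<close> by \<open>1 / (1 + \<bar>a - b\<bar>)\<close>. With \<open>L = n div 2\<close> scales the
  total weight is of order \<open>L * ln L\<close>, whereas one existential query changes the weighted overlap
  by only \<open>O(L)\<close>, because Hilbert's kernel is a bounded operator. On the other hand an index that is
  correct for \<open>X\<close> is almost never correct for an independent \<open>Y\<close>, so success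
  forces the overlap to drop by a constant fraction. Classical queries are handled in the same way:
  if the run stops as soon as one of them hits \<open>X\<close>, each of them decreases the overlap only
  negligibly.
\<close>

section \<open>A Hilbert-type inequality\<close>

text \<open>Telescoping: for consecutive roots \<open>s\<close>, \<open>t\<close> the inequality
  \<open>2 * s * t \<le> s\<^sup>2 + t\<^sup>2 = 2 * t\<^sup>2 - 1\<close> gives
  \<open>1 / t \<le> 2 * (t - s)\<close>.\<close>

lemma sum_inverse_sqrt_le: "(\<Sum>y=1..m. 1 / sqrt (real y)) \<le> 2 * sqrt (real m)"
proof (induction m)
  case (Suc m)
  define s where "s = sqrt (real m)"
  define t where "t = sqrt (real (Suc m))"
  have t: "t > 0" "t\<^sup>2 = s\<^sup>2 + 1" by (auto simp: s_def t_def)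
  have "2 * s * t + 1 \<le> 2 * t\<^sup>2" using sum_squares_bound[of s t] t by linarith
  then have "2 * s + 1 / t \<le> 2 * t" using t by (simp add: field_simps power2_eq_square)
  with Suc.IH show ?case by (simp add: s_def t_def)
qed simp

lemma sum_inverse_mult_sqrt_le:
  assumes "1 \<le> x" "x \<le> m"
  shows "(\<Sum>y\<in>{x<..m}. 1 / (real y * sqrt (real y))) \<le> 2 / sqrt (real x) - 2 / sqrt (real m)"
  using assms(2)
proof (induction m rule: dec_induct)
  case (step m)
  define s where "s = sqrt (real m)"
  define t where "t = sqrt (real (Suc m))"
  have s: "s > 0" "s \<le> t" "t\<^sup>2 = s\<^sup>2 + 1" using step assms by (auto simp: s_def t_def)
  have "(t + s) * (t - s) = 1" using s(3) by (simp add: power2_eq_square algebra_simps)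
  moreover have "(t + s) * (t - s) \<le> (2 * t) * (t - s)"
    using s by (intro mult_right_mono) auto
  ultimately have "1 \<le> 2 * t * (t - s)" by linarith
  then have "s * 1 \<le> t * (2 * t * (t - s))"
    using s by (intro mult_mono) auto
  then have "s / (s * (t\<^sup>2 * t)) \<le> t * (2 * t * (t - s)) / (s * (t\<^sup>2 * t))"
    using s by (intro divide_right_mono) auto
  also have "\<dots> = 2 / s - 2 / t" using s(1,2) by (simp add: field_simps power2_eq_square)
  finally have "1 / (t\<^sup>2 * t) \<le> 2 / s - 2 / t" using s(1) by simp
  moreover have "{x<..Suc m} = insert (Suc m) {x<..m}" using step by auto
  ultimately show ?case using step by (simp add: s_def t_def)
qed simp

text \<open>Row bound for the Schur test. Dropping \<open>y\<close> from the denominator for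
  \<open>y \<le> x\<close> and \<open>x\<close> for \<open>y > x\<close> leaves the two sums above,
  each contributing at most 2 uniformly in \<open>x\<close> and \<open>m\<close>.\<close>

lemma sum_hilbert_row_le:
  assumes "1 \<le> x"
  shows "(\<Sum>y=1..m. sqrt (real x / real y) / (real x + real y)) \<le> 4"
proof -
  define f where "f y = sqrt (real x / real y) / (real x + real y)" for y :: nat
  have xs: "sqrt (real x) > 0" "sqrt (real x) * sqrt (real x) = real x" using assms by auto
  have small: "(\<Sum>y=1..x. f y) \<le> 2"
  proof -
    have "f y \<le> (1 / sqrt (real x)) * (1 / sqrt (real y))" if "y \<in> {1..x}" for y
    proof -
      have y: "sqrt (real y) > 0" using that by simp
      have "f y \<le> (sqrt (real x) / sqrt (real y)) / real x"
        unfolding f_def real_sqrt_divide using assms y that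
        by (intro divide_left_mono) auto
      also have "\<dots> = (1 / sqrt (real x)) * (1 / sqrt (real y))"
        using xs y by (simp add: field_simps)
      finally show ?thesis .
    qed
    then have "(\<Sum>y=1..x. f y) \<le> (\<Sum>y=1..x. (1 / sqrt (real x)) * (1 / sqrt (real y)))"
      by (intro sum_mono) auto
    also have "\<dots> = (1 / sqrt (real x)) * (\<Sum>y=1..x. 1 / sqrt (real y))"
      by (simp only: sum_distrib_left)
    also have "\<dots> \<le> (1 / sqrt (real x)) * (2 * sqrt (real x))"
      using xs by (intro mult_left_mono sum_inverse_sqrt_le) auto
    also have "\<dots> = 2" using xs by simp
    finally show ?thesis .
  qed
  have large: "(\<Sum>y\<in>{x<..m}. f y) \<le> 2"
  proof (cases "x \<le> m")
    case True
    have "f y \<le> sqrt (real x) * (1 / (real y * sqrt (real y)))" if "y \<in> {x<..m}" for y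
    proof -
      have y: "sqrt (real y) > 0" using that by simp
      have "f y \<le> (sqrt (real x) / sqrt (real y)) / real y"
        unfolding f_def real_sqrt_divide using assms y that
        by (intro divide_left_mono) auto
      then show ?thesis by (simp add: mult.commute)
    qed
    then have "(\<Sum>y\<in>{x<..m}. f y) \<le> (\<Sum>y\<in>{x<..m}. sqrt (real x) * (1 / (real y * sqrt (real y))))"
      by (intro sum_mono) auto
    also have "\<dots> = sqrt (real x) * (\<Sum>y\<in>{x<..m}. 1 / (real y * sqrt (real y)))"
      by (simp only: sum_distrib_left)
    also have "\<dots> \<le> sqrt (real x) * (2 / sqrt (real x) - 2 / sqrt (real m))"
      using xs by (intro mult_left_mono sum_inverse_mult_sqrt_le assms True) auto
    also have "\<dots> \<le> 2" using xs by (simp add: right_diff_distrib)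
    finally show ?thesis .
  qed simp
  have "(\<Sum>y=1..m. f y) \<le> (\<Sum>y\<in>{1..x} \<union> {x<..m}. f y)"
    by (intro sum_mono2) (auto simp: f_def)
  also have "\<dots> = (\<Sum>y=1..x. f y) + (\<Sum>y\<in>{x<..m}. f y)"
    by (intro sum.union_disjoint) auto
  finally show ?thesis using small large by (simp add: f_def)
qed

text \<open>This is \<open>1 + \<bar>a - m\<bar>\<close>, written with truncated subtraction so that
  it stays a natural number and sums can be reindexed by its values.\<close>

definition offset :: "nat \<Rightarrow> nat \<Rightarrow> nat" where
  "offset m a = 1 + (a - m) + (m - a)"

lemma offset_ge_1: "1 \<le> offset m a"
  by (simp add: offset_def)

text \<open>On each side of \<open>m\<close> the offset is injective, so every value
  \<open>y\<close> occurs at most twice.\<close>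

lemma sum_offset_le:
  fixes f :: "nat \<Rightarrow> real"
  assumes "\<And>y. 0 \<le> f y"
  shows "(\<Sum>b<L. f (offset m b)) \<le> 2 * (\<Sum>y=1..1+L+m. f y)"
proof -
  have part: "(\<Sum>b\<in>B. f (offset m b)) \<le> (\<Sum>y=1..1+L+m. f y)"
    if "B \<subseteq> {..<L}" "inj_on (offset m) B" for B
  proof -
    have "(\<Sum>b\<in>B. f (offset m b)) = (\<Sum>y\<in>offset m ` B. f y)"
      using that by (simp add: sum.reindex)
    also have "\<dots> \<le> (\<Sum>y=1..1+L+m. f y)"
      using that assms by (intro sum_mono2) (auto simp: offset_def)
    finally show ?thesis .
  qed
  have "(\<Sum>b<L. f (offset m b))
      = (\<Sum>b\<in>({..<L} \<inter> {..<m}) \<union> ({..<L} \<inter> {m..}). f (offset m b))"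
    by (intro sum.cong) auto
  also have "\<dots> = (\<Sum>b\<in>{..<L} \<inter> {..<m}. f (offset m b)) + (\<Sum>b\<in>{..<L} \<inter> {m..}. f (offset m b))"
    by (intro sum.union_disjoint) auto
  also have "\<dots> \<le> (\<Sum>y=1..1+L+m. f y) + (\<Sum>y=1..1+L+m. f y)"
    by (intro add_mono part) (auto simp: inj_on_def offset_def)
  finally show ?thesis by simp
qed

text \<open>Schur test with the weights \<open>sqrt (x / y)\<close> for the kernel \<open>1 / (x + y)\<close>.\<close>

lemma hilbert_offset_form_le:
  fixes v :: "nat \<Rightarrow> real"
  shows "(\<Sum>a<L. \<Sum>b<L. v a * v b / (real (offset m a) + real (offset m b))) \<le> 8 * (\<Sum>a<L. (v a)\<^sup>2)"
proof -
  define x where "x a = real (offset m a)" for a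
  define R where "R a b = sqrt (x a / x b) / (x a + x b)" for a b
  have x: "x a \<ge> 1" for a using offset_ge_1[of m a] by (simp add: x_def)
  have x0: "x a > 0" for a using x[of a] by linarith
  have half: "p \<le> q / 2" if "2 * p \<le> q" for p q :: real using that by simp
  have row: "(\<Sum>b<L. R a b) \<le> 8" for a
  proof -
    have "(\<Sum>b<L. R a b)
        = (\<Sum>b<L. (\<lambda>y. sqrt (real (offset m a) / real y) / (real (offset m a) + real y)) (offset m b))"
      by (simp add: R_def x_def)
    also have "\<dots> \<le> 2 * (\<Sum>y=1..1+L+m. sqrt (real (offset m a) / real y) / (real (offset m a) + real y))"
      by (rule sum_offset_le) simp
    also have "\<dots> \<le> 2 * 4"
      by (intro mult_left_mono sum_hilbert_row_le offset_ge_1) auto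
    finally show ?thesis by simp
  qed
  have term_le: "v a * v b / (x a + x b) \<le> ((v a)\<^sup>2 * R a b + (v b)\<^sup>2 * R b a) / 2" for a b
  proof -
    define t where "t = sqrt (x a / x b)"
    have t: "t > 0" using x0 by (simp add: t_def)
    have t': "sqrt (x b / x a) = 1 / t" by (simp add: t_def real_sqrt_divide)
    \<comment> \<open>AM-GM balanced by \<open>t\<close>: after division by \<open>t\<close> the two
      squares carry the weights of \<open>R a b\<close> and \<open>R b a\<close>.\<close>
    have "2 * (v a * t) * v b \<le> (v a * t)\<^sup>2 + (v b)\<^sup>2" by (rule sum_squares_bound)
    then have "2 * (v a * v b) \<le> (v a)\<^sup>2 * t + (v b)\<^sup>2 * (1 / t)"
      using t by (simp add: field_simps power2_eq_square)
    then have "2 * (v a * v b) / (x a + x b) \<le> ((v a)\<^sup>2 * t + (v b)\<^sup>2 * (1 / t)) / (x a + x b)"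
      using x0[of a] x0[of b] by (intro divide_right_mono) auto
    also have "\<dots> = (v a)\<^sup>2 * R a b + (v b)\<^sup>2 * R b a"
      unfolding R_def t_def[symmetric] t' by (simp add: add_divide_distrib add.commute)
    finally have "2 * (v a * v b / (x a + x b)) \<le> (v a)\<^sup>2 * R a b + (v b)\<^sup>2 * R b a" by simp
    then show ?thesis by (rule half)
  qed
  have "(\<Sum>a<L. \<Sum>b<L. v a * v b / (x a + x b))
      \<le> (\<Sum>a<L. \<Sum>b<L. ((v a)\<^sup>2 * R a b + (v b)\<^sup>2 * R b a) / 2)"
    by (intro sum_mono term_le)
  also have "\<dots> = ((\<Sum>a<L. \<Sum>b<L. (v a)\<^sup>2 * R a b) + (\<Sum>a<L. \<Sum>b<L. (v b)\<^sup>2 * R b a)) / 2"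
    by (simp add: sum.distrib sum_divide_distrib[symmetric])
  also have "(\<Sum>a<L. \<Sum>b<L. (v b)\<^sup>2 * R b a) = (\<Sum>a<L. \<Sum>b<L. (v a)\<^sup>2 * R a b)"
    by (rule sum.swap)
  also have "((\<Sum>a<L. \<Sum>b<L. (v a)\<^sup>2 * R a b) + (\<Sum>a<L. \<Sum>b<L. (v a)\<^sup>2 * R a b)) / 2
      = (\<Sum>a<L. (v a)\<^sup>2 * (\<Sum>b<L. R a b))"
    by (simp only: sum_distrib_left) simp
  also have "\<dots> \<le> (\<Sum>a<L. (v a)\<^sup>2 * 8)"
    by (intro sum_mono mult_left_mono row) auto
  finally show ?thesis by (simp add: x_def sum_distrib_left mult.commute)
qed

section \<open>Hit and miss probabilities against the Hilbert kernel\<close>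

lemma Suc_square_le_power2: "(1 + real k)\<^sup>2 \<le> 9 / 2 * 2 ^ k"
proof (induction k rule: less_induct)
  case (less k)
  consider "k = 0" | "k = 1" | "k = 2" | j where "k = Suc j" "2 \<le> j"
    using that(4)[of "k - 1"] by (cases "k \<le> 2") (auto simp: le_Suc_eq numeral_2_eq_2)
  then show ?case
  proof cases
    case 4
    \<comment> \<open>From here on the left side at most doubles per step, because
      \<open>j * j \<ge> 2\<close>.\<close>
    have "(1 + real k)\<^sup>2 \<le> 2 * (1 + real j)\<^sup>2"
    proof -
      have "real j * real j \<ge> 2 * 2" using 4 by (intro mult_mono) auto
      then show ?thesis using 4 by (simp add: power2_eq_square algebra_simps)
    qed
    also have "\<dots> \<le> 2 * (9 / 2 * 2 ^ j)" using less.IH[of j] 4 by simp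
    finally show ?thesis using 4 by simp
  qed (auto simp: power2_eq_square)
qed

text \<open>Bernoulli bounds \<open>1 + M * r\<close> by \<open>(1 + r) ^ M\<close>, and
  \<open>(1 - r) ^ M * (1 + r) ^ M \<le> 1\<close>. Decay of order \<open>1 / (M * r)\<close>
  suffices, since \<open>M = 2 ^ b\<close> doubles from scale to scale.\<close>

lemma power_one_minus_le:
  fixes r :: real
  assumes "0 \<le> r" "r \<le> 1"
  shows "(1 - r) ^ M * (real M * r) \<le> 1"
proof -
  have "(1 - r) ^ M * (1 + real M * r) \<le> (1 - r) ^ M * (1 + r) ^ M"
    using assms by (intro mult_left_mono Bernoulli_inequality) auto
  also have "\<dots> = (1 - r\<^sup>2) ^ M"
    by (simp add: power_mult_distrib[symmetric] power2_eq_square algebra_simps)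
  also have "\<dots> \<le> 1"
    using assms by (intro power_le_one) (auto simp: power_le_one)
  finally have "(1 - r) ^ M + (1 - r) ^ M * (real M * r) \<le> 1" by (simp add: algebra_simps)
  moreover have "(1 - r) ^ M \<ge> 0" using assms by simp
  ultimately show ?thesis by linarith
qed

text \<open>With \<open>r = 2 powr (-m)\<close> up to a factor 2, a set of \<open>2 ^ a\<close> random points hits a set of
 density \<open>r\<close> with small probability for \<open>a < m\<close>, and misses it with small probability for
 \<open>a > m\<close>; both decay fast enough to replace the distance \<open>\<bar>a - b\<bar>\<close> by
 the Hilbert-type kernel centred at \<open>m\<close>.\<close>

lemma hit_miss_le:
  fixes r :: real
  assumes r: "0 < r" "r \<le> 1"
  obtains m where "\<And>a b. sqrt (1 - (1 - r) ^ (2 ^ a)) * sqrt ((1 - r) ^ (2 ^ b)) / (1 + \<bar>real a - real b\<bar>)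
      \<le> 6 / (real (offset m a) + real (offset m b))"
proof -
  obtain k where k: "1 / r < 2 ^ k" using real_arch_pow[of 2 "1 / r"] by auto
  \<comment> \<open>The critical scale is \<open>m = k0 - 1\<close>, so that
    \<open>2 ^ m \<le> 1 / r < 2 ^ (m + 1)\<close>.\<close>
  define k0 where "k0 = (LEAST k. 1 / r < 2 ^ k)"
  have k0: "1 / r < 2 ^ k0" unfolding k0_def using k by (rule LeastI)
  have "k0 \<noteq> 0"
  proof
    assume "k0 = 0"
    then show False using k0 r by (simp add: field_simps)
  qed
  then obtain m where m: "k0 = Suc m" by (cases k0) auto
  have lo: "2 ^ m * r \<le> 1"
  proof -
    have "\<not> 1 / r < 2 ^ m"
      using not_less_Least[of m "\<lambda>k. 1 / r < 2 ^ k"] m by (simp add: k0_def)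
    then show ?thesis using r by (simp add: field_simps)
  qed
  have hi: "1 \<le> 2 * (2 ^ m * r)" using k0 m r by (simp add: field_simps)
  define \<alpha> where "\<alpha> a = sqrt (1 - (1 - r) ^ (2 ^ a))" for a :: nat
  define \<beta> where "\<beta> b = sqrt ((1 - r) ^ (2 ^ b))" for b :: nat
  define x where "x a = real (offset m a)" for a
  have x: "x a \<ge> 1" for a using offset_ge_1[of m a] by (simp add: x_def)
  have xd: "x a \<le> x b + \<bar>real a - real b\<bar>" for a b unfolding x_def offset_def by linarith
  have p01: "0 \<le> (1 - r) ^ M" "(1 - r) ^ M \<le> 1" for M using r by (auto intro: power_le_one)
  have \<alpha>: "0 \<le> \<alpha> a" "\<alpha> a \<le> 1" and \<beta>: "0 \<le> \<beta> a" "\<beta> a \<le> 1" for a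
    using p01 by (auto simp: \<alpha>_def \<beta>_def)
  have low: "\<alpha> a * x a \<le> 3" if "a \<le> m" for a
  proof -
    \<comment> \<open>Union bound: \<open>2 ^ a\<close> samples hit a set of density
      \<open>r\<close> with probability at most \<open>2 ^ a * r\<close>.\<close>
    have "1 - real (2 ^ a) * r \<le> (1 - r) ^ (2 ^ a)"
      using Bernoulli_inequality[of "- r" "2 ^ a"] r by simp
    then have "(\<alpha> a)\<^sup>2 \<le> 2 ^ a * r" using p01 by (simp add: \<alpha>_def)
    then have "(\<alpha> a)\<^sup>2 * 2 ^ (m - a) \<le> 2 ^ a * r * 2 ^ (m - a)" by (intro mult_right_mono) auto
    also have "\<dots> = 2 ^ m * r"
      using that by (simp add: power_add[symmetric] mult.commute mult.left_commute)
    finally have 1: "(\<alpha> a)\<^sup>2 * 2 ^ (m - a) \<le> 1" using lo by linarith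
    have "x a = 1 + real (m - a)" using that by (simp add: x_def offset_def)
    \<comment> \<open>The constant \<open>9 / 2\<close> serves both sides of \<open>m\<close>: the
      factor 1 obtained here and the factor 2 obtained below both keep the square under
      \<open>9\<close>.\<close>
    then have "(x a)\<^sup>2 \<le> 9 / 2 * 2 ^ (m - a)" using Suc_square_le_power2[of "m - a"] by simp
    then have "(\<alpha> a * x a)\<^sup>2 \<le> (\<alpha> a)\<^sup>2 * (9 / 2 * 2 ^ (m - a))"
      by (simp only: power_mult_distrib) (intro mult_left_mono, auto)
    also have "\<dots> \<le> 3\<^sup>2" using 1 by simp
    finally show ?thesis by (rule power2_le_imp_le) simp
  qed
  have high: "\<beta> b * x b \<le> 3" if "m \<le> b" for b
  proof -
    have sq: "(\<beta> b)\<^sup>2 = (1 - r) ^ (2 ^ b)" using p01 by (simp add: \<beta>_def)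
    \<comment> \<open>Inserting \<open>2 * (2 ^ m * r) \<ge> 1\<close> turns
      \<open>2 ^ (b - m)\<close> into \<open>2 * (2 ^ b * r)\<close>, the form needed for
      \<open>power_one_minus_le\<close>.\<close>
    have "(\<beta> b)\<^sup>2 * 2 ^ (b - m) \<le> (\<beta> b)\<^sup>2 * 2 ^ (b - m) * (2 * (2 ^ m * r))"
      using mult_left_mono[OF hi, of "(\<beta> b)\<^sup>2 * 2 ^ (b - m)"] by simp
    also have "\<dots> = 2 * ((\<beta> b)\<^sup>2 * (2 ^ (b - m + m) * r))"
      by (simp add: power_add mult_ac)
    also have "\<dots> \<le> 2"
      using power_one_minus_le[of r "2 ^ b"] r that sq by simp
    finally have 1: "(\<beta> b)\<^sup>2 * 2 ^ (b - m) \<le> 2" .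
    have "x b = 1 + real (b - m)" using that by (simp add: x_def offset_def)
    then have "(x b)\<^sup>2 \<le> 9 / 2 * 2 ^ (b - m)" using Suc_square_le_power2[of "b - m"] by simp
    then have "(\<beta> b * x b)\<^sup>2 \<le> (\<beta> b)\<^sup>2 * (9 / 2 * 2 ^ (b - m))"
      by (simp only: power_mult_distrib) (intro mult_left_mono, auto)
    also have "\<dots> \<le> 3\<^sup>2" using 1 by simp
    finally show ?thesis by (rule power2_le_imp_le) simp
  qed
  have "\<alpha> a * \<beta> b * (x a + x b) \<le> 6 * (1 + \<bar>real a - real b\<bar>)" for a b
  proof -
    have ab: "0 \<le> \<alpha> a * \<beta> b" "\<alpha> a * \<beta> b \<le> \<alpha> a" "\<alpha> a * \<beta> b \<le> \<beta> b" "\<alpha> a * \<beta> b \<le> 1"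
      using \<alpha>[of a] \<beta>[of b] by (auto simp: mult_left_le mult_left_le_one_le mult_le_one)
    have ab_d: "\<alpha> a * \<beta> b * \<bar>real a - real b\<bar> \<le> \<bar>real a - real b\<bar>"
      using ab by (intro mult_left_le_one_le) auto
    consider "a \<le> m" | "m \<le> b" | "b < m" "m < a" by linarith
    then show ?thesis
    proof cases
      case 1
      have "\<alpha> a * \<beta> b * (x a + x b) \<le> \<alpha> a * \<beta> b * (2 * x a + \<bar>real a - real b\<bar>)"
        using xd[of b a] ab by (intro mult_left_mono) auto
      moreover have "\<alpha> a * \<beta> b * x a \<le> \<alpha> a * x a"
        using ab x[of a] by (intro mult_right_mono) auto
      moreover have "\<alpha> a * \<beta> b * (2 * x a + \<bar>real a - real b\<bar>)
          = 2 * (\<alpha> a * \<beta> b * x a) + \<alpha> a * \<beta> b * \<bar>real a - real b\<bar>"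
        by (simp add: algebra_simps)
      ultimately show ?thesis using low[OF 1] ab_d by argo
    next
      case 2
      have "\<alpha> a * \<beta> b * (x a + x b) \<le> \<alpha> a * \<beta> b * (2 * x b + \<bar>real a - real b\<bar>)"
        using xd[of a b] ab by (intro mult_left_mono) auto
      moreover have "\<alpha> a * \<beta> b * x b \<le> \<beta> b * x b"
        using ab x[of b] by (intro mult_right_mono) auto
      moreover have "\<alpha> a * \<beta> b * (2 * x b + \<bar>real a - real b\<bar>)
          = 2 * (\<alpha> a * \<beta> b * x b) + \<alpha> a * \<beta> b * \<bar>real a - real b\<bar>"
        by (simp add: algebra_simps)
      ultimately show ?thesis using high[OF 2] ab_d by argo
    next
      case 3
      have "x a + x b = 2 + \<bar>real a - real b\<bar>" using 3 by (simp add: x_def offset_def)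
      then have *: "x a + x b \<le> 6 * (1 + \<bar>real a - real b\<bar>)"
        using abs_ge_zero[of "real a - real b"] by argo
      have "\<alpha> a * \<beta> b * (x a + x b) \<le> x a + x b"
        using ab x[of a] x[of b] by (intro mult_left_le_one_le) auto
      then show ?thesis using * by (rule order_trans)
    qed
  qed
  moreover have "x a + x b > 0" for a b using x[of a] x[of b] by linarith
  ultimately have "\<alpha> a * \<beta> b / (1 + \<bar>real a - real b\<bar>) \<le> 6 / (x a + x b)" for a b
    by (simp add: field_simps)
  then show thesis using that unfolding \<alpha>_def \<beta>_def x_def by blast
qed

section \<open>Random inputs\<close>

text \<open>Serves twice: as the sample space of random inputs and as the set of histories of
  classically queried indices.\<close>

definition words :: "nat \<Rightarrow> nat \<Rightarrow> nat list set" where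
  "words N m = {xs. set xs \<subseteq> {..<N} \<and> length xs = m}"

lemma finite_words [simp]: "finite (words N m)"
  by (simp add: words_def finite_lists_length_eq)

lemma card_words: "card (words N m) = N ^ m"
  by (simp add: words_def card_lists_length_eq)

lemma words_0: "words N 0 = {[]}"
  by (auto simp: words_def)

lemma sum_words_Suc: "(\<Sum>h\<in>words N (Suc m). f h) = (\<Sum>h\<in>words N m. \<Sum>i<N. f (i # h))"
proof -
  have "inj_on (\<lambda>(xs, n). n # xs) (words N m \<times> {..<N})" by (auto simp: inj_on_def)
  then have "(\<Sum>h\<in>words N (Suc m). f h) = (\<Sum>(xs, i)\<in>words N m \<times> {..<N}. f (i # xs))"
    unfolding words_def lists_length_Suc_eq by (subst sum.reindex) (auto intro!: sum.cong)
  then show ?thesis by (simp add: sum.cartesian_product)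
qed

text \<open>Expectation of \<open>g X\<close> when \<open>X\<close> is the set of values of \<open>M\<close> independent uniform samples from
 \<open>{..<N}\<close>. Sampling with replacement keeps \<open>X\<close> nonempty.\<close>

definition avg :: "nat \<Rightarrow> nat \<Rightarrow> (nat set \<Rightarrow> real) \<Rightarrow> real" where
  "avg N M g = (\<Sum>xs\<in>words N M. g (set xs)) / real N ^ M"

lemma avg_const: "N > 0 \<Longrightarrow> avg N M (\<lambda>_. c) = c"
  by (simp add: avg_def card_words)

lemma avg_add: "avg N M (\<lambda>X. f X + g X) = avg N M f + avg N M g"
  by (simp add: avg_def sum.distrib add_divide_distrib)

lemma avg_cmult: "avg N M (\<lambda>X. c * f X) = c * avg N M f"
  by (simp add: avg_def sum_distrib_left)

lemma avg_sum: "avg N M (\<lambda>X. \<Sum>k\<in>K. f k X) = (\<Sum>k\<in>K. avg N M (f k))"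
  unfolding avg_def by (subst sum.swap) (simp add: sum_divide_distrib)

lemma avg_mono:
  assumes "\<And>X. X \<subseteq> {..<N} \<Longrightarrow> (M > 0 \<Longrightarrow> X \<noteq> {}) \<Longrightarrow> f X \<le> g X"
  shows "avg N M f \<le> avg N M g"
  unfolding avg_def using assms by (intro divide_right_mono sum_mono) (auto simp: words_def)

lemma avg_nonneg: "(\<And>X. 0 \<le> f X) \<Longrightarrow> 0 \<le> avg N M f"
  by (simp add: avg_def sum_nonneg)

lemma avg_swap: "avg N M (\<lambda>X. avg N M' (\<lambda>Y. f X Y)) = avg N M' (\<lambda>Y. avg N M (\<lambda>X. f X Y))"
proof -
  have "avg N M (\<lambda>X. avg N M' (\<lambda>Y. f X Y))
      = (\<Sum>xs\<in>words N M. \<Sum>ys\<in>words N M'. f (set xs) (set ys)) / (real N ^ M' * real N ^ M)"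
    by (simp add: avg_def sum_divide_distrib[symmetric])
  also have "(\<Sum>xs\<in>words N M. \<Sum>ys\<in>words N M'. f (set xs) (set ys))
      = (\<Sum>ys\<in>words N M'. \<Sum>xs\<in>words N M. f (set xs) (set ys))"
    by (rule sum.swap)
  finally show ?thesis by (simp add: avg_def sum_divide_distrib[symmetric] mult.commute)
qed

lemma avg_mult: "avg N M (\<lambda>X. avg N M' (\<lambda>Y. f X * g Y)) = avg N M f * avg N M' g"
  by (simp only: avg_cmult mult.commute[of _ "avg N M' g"])

lemma avg_miss:
  assumes "N > 0" "Z \<subseteq> {..<N}"
  shows "avg N M (\<lambda>X. of_bool (\<not> overlap X Z)) = (1 - real (card Z) / real N) ^ M"
proof -
  have fin: "finite Z" using assms finite_subset by blast
  have "(\<Sum>xs\<in>words N M. of_bool (\<not> overlap (set xs) Z)) = real (card {xs\<in>words N M. \<not> overlap (set xs) Z})"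
    by (simp add: of_bool_def sum.If_cases Int_def)
  also have "{xs\<in>words N M. \<not> overlap (set xs) Z} = {xs. set xs \<subseteq> {..<N} - Z \<and> length xs = M}"
    by (auto simp: words_def overlap_def)
  also have "card \<dots> = (N - card Z) ^ M"
    using assms fin by (subst card_lists_length_eq) (auto simp: card_Diff_subset)
  also have "real (N - card Z) = real N - real (card Z)"
    using assms card_mono[of "{..<N}" Z] by (simp add: of_nat_diff)
  then have "real ((N - card Z) ^ M) = (real N - real (card Z)) ^ M" by simp
  finally show ?thesis
    using assms by (simp add: avg_def power_divide[symmetric] diff_divide_distrib)
qed

lemma avg_hit:
  assumes "N > 0" "Z \<subseteq> {..<N}"
  shows "avg N M (\<lambda>X. of_bool (overlap X Z)) = 1 - (1 - real (card Z) / real N) ^ M"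
proof -
  have "(\<lambda>X. of_bool (overlap X Z) + of_bool (\<not> overlap X Z)) = (\<lambda>_. 1 :: real)" by auto
  then have "avg N M (\<lambda>X. of_bool (overlap X Z)) + avg N M (\<lambda>X. of_bool (\<not> overlap X Z)) = 1"
    using assms by (simp add: avg_add[symmetric] avg_const)
  then show ?thesis unfolding avg_miss[OF assms] by simp
qed

lemma avg_mem_le:
  assumes "i < N"
  shows "avg N M (\<lambda>X. of_bool (i \<in> X)) \<le> real M / real N"
proof -
  have "avg N M (\<lambda>X. of_bool (i \<in> X)) = avg N M (\<lambda>X. of_bool (overlap X {i}))"
    by (simp add: overlap_def)
  also have "\<dots> = 1 - (1 - 1 / real N) ^ M" using assms by (subst avg_hit) auto
  also have "\<dots> \<le> real M / real N"
    using Bernoulli_inequality[of "- (1 / real N)" M] assms by simp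
  finally show ?thesis .
qed

lemma avg_Cauchy_Schwarz:
  assumes "N > 0"
  shows "avg N M (\<lambda>X. of_bool (P X) * u X) \<le> sqrt (avg N M (\<lambda>X. of_bool (P X))) * sqrt (avg N M (\<lambda>X. (u X)\<^sup>2))"
proof -
  have sq: "(of_bool (P X) :: real)\<^sup>2 = of_bool (P X)" for X by simp
  have "(\<Sum>xs\<in>words N M. of_bool (P (set xs)) * u (set xs))\<^sup>2
     \<le> (\<Sum>xs\<in>words N M. (of_bool (P (set xs)))\<^sup>2) * (\<Sum>xs\<in>words N M. (u (set xs))\<^sup>2)"
    by (rule Cauchy_Schwarz_ineq_sum)
  then have "(avg N M (\<lambda>X. of_bool (P X) * u X))\<^sup>2
     \<le> (\<Sum>xs\<in>words N M. (of_bool (P (set xs)))\<^sup>2) * (\<Sum>xs\<in>words N M. (u (set xs))\<^sup>2) / (real N ^ M)\<^sup>2"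
    unfolding avg_def power_divide by (rule divide_right_mono) simp
  also have "\<dots> = avg N M (\<lambda>X. of_bool (P X)) * avg N M (\<lambda>X. (u X)\<^sup>2)"
    unfolding avg_def sq by (simp add: power2_eq_square)
  finally show ?thesis
    by (metis real_le_rsqrt real_sqrt_mult)
qed

section \<open>Weighted averages over pairs of scales\<close>

definition pavg :: "nat \<Rightarrow> nat \<Rightarrow> (nat set \<Rightarrow> nat set \<Rightarrow> real) \<Rightarrow> real" where
  "pavg N L G = (\<Sum>a<L. \<Sum>b<L. avg N (2 ^ a) (\<lambda>X. avg N (2 ^ b) (G X)) / (1 + \<bar>real a - real b\<bar>))"

text \<open>Total mass of the unnormalised \<open>pavg\<close>. The lower bound rests on this mass
  exceeding the loss per existential query, linear in \<open>L\<close>, by a logarithmic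
  factor.\<close>

definition hilbert_weight :: "nat \<Rightarrow> real" where
  "hilbert_weight L = (\<Sum>a<L. \<Sum>b<L. 1 / (1 + \<bar>real a - real b\<bar>))"

lemma pavg_add: "pavg N L (\<lambda>X Y. f X Y + g X Y) = pavg N L f + pavg N L g"
  by (simp add: pavg_def avg_add sum.distrib add_divide_distrib)

lemma pavg_cmult: "pavg N L (\<lambda>X Y. c * f X Y) = c * pavg N L f"
  by (simp add: pavg_def avg_cmult sum_distrib_left)

lemma pavg_sum: "pavg N L (\<lambda>X Y. \<Sum>k\<in>K. f k X Y) = (\<Sum>k\<in>K. pavg N L (f k))"
proof -
  have "pavg N L (\<lambda>X Y. \<Sum>k\<in>K. f k X Y)
      = (\<Sum>a<L. \<Sum>b<L. \<Sum>k\<in>K. avg N (2 ^ a) (\<lambda>X. avg N (2 ^ b) (f k X)) / (1 + \<bar>real a - real b\<bar>))"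
    by (simp add: pavg_def avg_sum sum_divide_distrib)
  also have "\<dots> = (\<Sum>a<L. \<Sum>k\<in>K. \<Sum>b<L. avg N (2 ^ a) (\<lambda>X. avg N (2 ^ b) (f k X)) / (1 + \<bar>real a - real b\<bar>))"
    by (intro sum.cong refl sum.swap)
  also have "\<dots> = (\<Sum>k\<in>K. pavg N L (f k))"
    unfolding pavg_def by (rule sum.swap)
  finally show ?thesis .
qed

lemma pavg_swap: "pavg N L (\<lambda>X Y. f Y X) = pavg N L f"
  unfolding pavg_def
  by (subst sum.swap, intro sum.cong refl, subst avg_swap) (simp add: abs_minus_commute)

lemma pavg_const: "N > 0 \<Longrightarrow> pavg N L (\<lambda>_ _. c) = hilbert_weight L * c"
  by (simp add: pavg_def hilbert_weight_def avg_const sum_distrib_right)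

text \<open>Every scale draws at least one sample, so pointwise bounds are needed for nonempty
  inputs only, where success is guaranteed.\<close>

lemma pavg_mono:
  assumes "\<And>X Y. X \<subseteq> {..<N} \<Longrightarrow> X \<noteq> {} \<Longrightarrow> Y \<subseteq> {..<N} \<Longrightarrow> Y \<noteq> {} \<Longrightarrow> f X Y \<le> g X Y"
  shows "pavg N L f \<le> pavg N L g"
  unfolding pavg_def by (intro sum_mono divide_right_mono avg_mono assms) auto

lemma pavg_le_inner:
  assumes "N > 0" "\<And>a X. a < L \<Longrightarrow> avg N (2 ^ a) (f X) \<le> c"
  shows "pavg N L f \<le> hilbert_weight L * c"
proof -
  have "pavg N L f \<le> (\<Sum>a<L. \<Sum>b<L. avg N (2 ^ a) (\<lambda>X. c) / (1 + \<bar>real a - real b\<bar>))"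
    unfolding pavg_def by (intro sum_mono divide_right_mono avg_mono assms) auto
  also have "\<dots> = hilbert_weight L * c"
    using assms by (simp add: hilbert_weight_def avg_const sum_distrib_right)
  finally show ?thesis .
qed

text \<open>Independence of \<open>X\<close> and \<open>Y\<close> factorises each pair of scales,
  Cauchy-Schwarz separates hit and miss probabilities from the second moments, and the Hilbert-type
  inequality sums over the scales. The constant is \<open>6 * 8\<close>, kernel comparison times
  Schur bound.\<close>

lemma pavg_hit_miss_le:
  assumes N: "N > 0" and Z: "Z \<subseteq> {..<N}" and u: "\<And>X. 0 \<le> u X"
  shows "pavg N L (\<lambda>X Y. of_bool (overlap X Z \<and> \<not> overlap Y Z) * (u X * u Y))
     \<le> 48 * (\<Sum>a<L. avg N (2 ^ a) (\<lambda>X. (u X)\<^sup>2))"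
proof -
  define r where "r = real (card Z) / real N"
  define v where "v a = sqrt (avg N (2 ^ a) (\<lambda>X. (u X)\<^sup>2))" for a
  have "card Z \<le> N" using Z card_mono[of "{..<N}" Z] by simp
  then have r: "0 \<le> r" "r \<le> 1" using N by (auto simp: r_def)
  have v0: "0 \<le> v a" for a by (simp add: v_def avg_nonneg)
  have v2: "(v a)\<^sup>2 = avg N (2 ^ a) (\<lambda>X. (u X)\<^sup>2)" for a by (simp add: v_def avg_nonneg)
  obtain m where m: "sqrt (1 - (1 - r) ^ (2 ^ a)) * sqrt ((1 - r) ^ (2 ^ b)) / (1 + \<bar>real a - real b\<bar>)
      \<le> 6 / (real (offset m a) + real (offset m b))" for a b
  \<comment> \<open>For \<open>r = 0\<close> the set \<open>Z\<close> is never hit, so the left side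
    vanishes and any centre works.\<close>
  proof (cases "r = 0")
    case True
    then show thesis using that by simp
  next
    case False
    then have "0 < r" using r by simp
    then show thesis by (rule hit_miss_le) (rule r, rule that)
  qed
  have "pavg N L (\<lambda>X Y. of_bool (overlap X Z \<and> \<not> overlap Y Z) * (u X * u Y))
      = (\<Sum>a<L. \<Sum>b<L. avg N (2 ^ a) (\<lambda>X. of_bool (overlap X Z) * u X)
          * avg N (2 ^ b) (\<lambda>Y. of_bool (\<not> overlap Y Z) * u Y) / (1 + \<bar>real a - real b\<bar>))"
  proof -
    have "avg N M (\<lambda>X. avg N M' (\<lambda>Y. of_bool (overlap X Z \<and> \<not> overlap Y Z) * (u X * u Y)))
       = avg N M (\<lambda>X. avg N M' (\<lambda>Y. (of_bool (overlap X Z) * u X) * (of_bool (\<not> overlap Y Z) * u Y)))" for M M'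
      by (simp add: of_bool_conj mult_ac)
    then show ?thesis unfolding pavg_def by (simp only: avg_mult)
  qed
  also have "\<dots> \<le> (\<Sum>a<L. \<Sum>b<L. 6 * (v a * v b / (real (offset m a) + real (offset m b))))"
  proof (intro sum_mono)
    fix a b
    have "avg N (2 ^ a) (\<lambda>X. of_bool (overlap X Z) * u X) * avg N (2 ^ b) (\<lambda>Y. of_bool (\<not> overlap Y Z) * u Y)
       \<le> (sqrt (1 - (1 - r) ^ (2 ^ a)) * v a) * (sqrt ((1 - r) ^ (2 ^ b)) * v b)"
      using avg_Cauchy_Schwarz[OF N, of "2 ^ a" "\<lambda>X. overlap X Z" u]
            avg_Cauchy_Schwarz[OF N, of "2 ^ b" "\<lambda>X. \<not> overlap X Z" u]
      unfolding avg_hit[OF N Z] avg_miss[OF N Z] r_def[symmetric] v_def[symmetric]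
      using u r v0 by (intro mult_mono) (auto intro!: avg_nonneg mult_nonneg_nonneg simp: power_le_one)
    then have "avg N (2 ^ a) (\<lambda>X. of_bool (overlap X Z) * u X) * avg N (2 ^ b) (\<lambda>Y. of_bool (\<not> overlap Y Z) * u Y)
          / (1 + \<bar>real a - real b\<bar>)
       \<le> (sqrt (1 - (1 - r) ^ (2 ^ a)) * v a) * (sqrt ((1 - r) ^ (2 ^ b)) * v b) / (1 + \<bar>real a - real b\<bar>)"
      by (rule divide_right_mono) simp
    also have "\<dots> = (v a * v b) * (sqrt (1 - (1 - r) ^ (2 ^ a)) * sqrt ((1 - r) ^ (2 ^ b)) / (1 + \<bar>real a - real b\<bar>))"
      by (simp add: mult_ac)
    also have "\<dots> \<le> (v a * v b) * (6 / (real (offset m a) + real (offset m b)))"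
      using v0 by (intro mult_left_mono m) auto
    finally show "avg N (2 ^ a) (\<lambda>X. of_bool (overlap X Z) * u X) * avg N (2 ^ b) (\<lambda>Y. of_bool (\<not> overlap Y Z) * u Y)
          / (1 + \<bar>real a - real b\<bar>) \<le> 6 * (v a * v b / (real (offset m a) + real (offset m b)))"
      by (simp add: mult_ac)
  qed
  also have "\<dots> = 6 * (\<Sum>a<L. \<Sum>b<L. v a * v b / (real (offset m a) + real (offset m b)))"
    by (simp only: sum_distrib_left)
  also have "\<dots> \<le> 6 * (8 * (\<Sum>a<L. (v a)\<^sup>2))"
    by (intro mult_left_mono hilbert_offset_form_le) auto
  finally show ?thesis by (simp add: v2)
qed

text \<open>Each row \<open>a\<close> in the upper half contains, up to its diagonal, the harmonic
  sum with \<open>a + 1 > L / 2\<close> terms, and there are at least \<open>L / 2\<close> such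
  rows.\<close>

lemma hilbert_weight_ge: "hilbert_weight L \<ge> real L / 2 * ln (real L / 2)"
proof (cases "L \<ge> 2")
  case True
  have row: "ln (real L / 2) \<le> (\<Sum>b<L. 1 / (1 + \<bar>real a - real b\<bar>))" if "a \<in> {L div 2..<L}" for a
  proof -
    have "ln (real L / 2) \<le> ln (real (Suc a) + 1)"
      using that True by (intro ln_mono) (auto simp: field_simps)
    also have "\<dots> \<le> harm (Suc a)" by (rule ln_le_harm)
    also have "\<dots> = (\<Sum>y=1..Suc a. 1 / real y)" by (simp add: harm_def inverse_eq_divide)
    also have "\<dots> = (\<Sum>b\<le>a. 1 / (1 + \<bar>real a - real b\<bar>))"
      by (rule sum.reindex_bij_witness[of _ "\<lambda>b. Suc a - b" "\<lambda>y. Suc a - y"]) (auto simp: of_nat_diff)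
    also have "\<dots> \<le> (\<Sum>b<L. 1 / (1 + \<bar>real a - real b\<bar>))"
      using that by (intro sum_mono2) auto
    finally show ?thesis .
  qed
  have "real L / 2 * ln (real L / 2) \<le> real (L - L div 2) * ln (real L / 2)"
    using True by (intro mult_right_mono) (auto simp: field_simps)
  also have "\<dots> = (\<Sum>a\<in>{L div 2..<L}. ln (real L / 2))" by simp
  also have "\<dots> \<le> (\<Sum>a\<in>{L div 2..<L}. \<Sum>b<L. 1 / (1 + \<bar>real a - real b\<bar>))"
    by (intro sum_mono row)
  also have "\<dots> \<le> hilbert_weight L"
    unfolding hilbert_weight_def by (intro sum_mono2) (auto intro: sum_nonneg)
  finally show ?thesis .
next
  case False
  then have "L = 0 \<or> L = 1" by linarith
  then have "real L / 2 * ln (real L / 2) \<le> 0" by (auto simp: ln_div)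
  also have "0 \<le> hilbert_weight L" unfolding hilbert_weight_def by (intro sum_nonneg) auto
  finally show ?thesis .
qed

section \<open>Unitary matrices\<close>

text \<open>\<open>is_unitary\<close> states orthonormality of the rows; a right inverse of a square
  matrix is also a left inverse, which gives the columns.\<close>

lemma is_unitary_columns:
  assumes U: "is_unitary d U" and "k < d" "l < d"
  shows "(\<Sum>a<d. cnj (U a k) * U a l) = (if k = l then 1 else 0)"
proof -
  define A where "A = mat d d (\<lambda>(i, j). U i j)"
  define B where "B = mat d d (\<lambda>(i, j). cnj (U j i))"
  have carrier: "A \<in> carrier_mat d d" "B \<in> carrier_mat d d" by (simp_all add: A_def B_def)
  have "A * B = 1\<^sub>m d"
  proof (intro eq_matI)
    fix i j assume ij: "i < dim_row (1\<^sub>m d :: complex mat)" "j < dim_col (1\<^sub>m d :: complex mat)"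
    then have "(A * B) $$ (i, j) = (\<Sum>k<d. U i k * cnj (U j k))"
      by (simp add: A_def B_def scalar_prod_def lessThan_atLeast0)
    then show "(A * B) $$ (i, j) = 1\<^sub>m d $$ (i, j)"
      using U ij by (simp add: is_unitary_def)
  qed (simp_all add: A_def B_def)
  then have "B * A = 1\<^sub>m d" by (rule mat_mult_left_right_inverse[OF carrier])
  then have "(B * A) $$ (k, l) = (if k = l then 1 else 0)" using assms by simp
  moreover have "(B * A) $$ (k, l) = (\<Sum>a<d. cnj (U a k) * U a l)"
    using assms by (simp add: A_def B_def scalar_prod_def lessThan_atLeast0)
  ultimately show ?thesis by simp
qed

lemma unitary_sum_mult_cnj:
  assumes U: "is_unitary d U"
  shows "(\<Sum>a<d. (\<Sum>k<d. U a k * f k) * cnj (\<Sum>l<d. U a l * g l)) = (\<Sum>k<d. f k * cnj (g k))"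
proof -
  have "(\<Sum>a<d. (\<Sum>k<d. U a k * f k) * cnj (\<Sum>l<d. U a l * g l))
      = (\<Sum>a<d. \<Sum>k<d. \<Sum>l<d. cnj (U a l) * U a k * (f k * cnj (g l)))"
    unfolding cnj_sum sum_product by (intro sum.cong refl) simp
  also have "\<dots> = (\<Sum>k<d. \<Sum>a<d. \<Sum>l<d. cnj (U a l) * U a k * (f k * cnj (g l)))"
    by (rule sum.swap)
  also have "\<dots> = (\<Sum>k<d. \<Sum>l<d. \<Sum>a<d. cnj (U a l) * U a k * (f k * cnj (g l)))"
    by (intro sum.cong refl sum.swap)
  also have "\<dots> = (\<Sum>k<d. \<Sum>l<d. (if l = k then 1 else 0) * (f k * cnj (g l)))"
    by (intro sum.cong refl, subst sum_distrib_right[symmetric], subst is_unitary_columns[OF U]) auto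
  also have "\<dots> = (\<Sum>k<d. \<Sum>l<d. if k = l then f k * cnj (g k) else 0)"
    by (intro sum.cong) auto
  also have "\<dots> = (\<Sum>k<d. f k * cnj (g k))" by simp
  finally show ?thesis .
qed

section \<open>Overlaps of runs on different inputs\<close>

text \<open>Purification of the dephasing in \<open>ClQuery\<close>: the amplitudes are indexed by the list \<open>h\<close> of the
 indices queried classically so far (latest first).\<close>

fun hist_step :: "nat set \<Rightarrow> nat \<Rightarrow> step \<Rightarrow> (nat list \<Rightarrow> nat \<Rightarrow> complex) \<Rightarrow> nat list \<Rightarrow> nat \<Rightarrow> complex" where
  "hist_step X d (Unitary U) \<phi> = (\<lambda>h a. \<Sum>k<d. U a k * \<phi> h k)"
| "hist_step X d (ExQuery zl) \<phi> = (\<lambda>h a. ex_sign X (zl a) * \<phi> h a)"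
| "hist_step X d (ClQuery il fl) \<phi> =
     (\<lambda>h a. case h of [] \<Rightarrow> 0 | i # h' \<Rightarrow> if il a = i then \<phi> h' (if il a \<in> X then fl a else a) else 0)"

definition hist :: "nat set \<Rightarrow> nat \<Rightarrow> step list \<Rightarrow> nat \<Rightarrow> nat list \<Rightarrow> nat \<Rightarrow> complex" where
  "hist X d ss w0 = fold (hist_step X d) ss (\<lambda>h a. if h = [] \<and> a = w0 then 1 else 0)"

lemma hist_Nil: "hist X d [] w0 = (\<lambda>h a. if h = [] \<and> a = w0 then 1 else 0)"
  by (simp add: hist_def)

lemma hist_snoc: "hist X d (ss @ [s]) w0 = hist_step X d s (hist X d ss w0)"
  by (simp add: hist_def)

lemma run_Nil: "run X d [] w0 = (\<lambda>a b. if a = w0 \<and> b = w0 then 1 else 0)"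
  by (simp add: run_def)

lemma run_snoc: "run X d (ss @ [s]) w0 = apply_step X d s (run X d ss w0)"
  by (simp add: run_def)

lemma num_cl_simps [simp]:
  "num_cl [] = 0" "num_cl (ss @ [Unitary U]) = num_cl ss"
  "num_cl (ss @ [ExQuery zl]) = num_cl ss" "num_cl (ss @ [ClQuery il fl]) = Suc (num_cl ss)"
  by (simp_all add: num_cl_def)

lemma num_ex_simps [simp]:
  "num_ex [] = 0" "num_ex (ss @ [Unitary U]) = num_ex ss"
  "num_ex (ss @ [ExQuery zl]) = Suc (num_ex ss)" "num_ex (ss @ [ClQuery il fl]) = num_ex ss"
  by (simp_all add: num_ex_def)

lemma ex_sign_mult_self [simp]: "ex_sign X Z * (ex_sign X Z * c) = c"
  by (simp add: ex_sign_def)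

lemma cnj_ex_sign [simp]: "cnj (ex_sign X Z) = ex_sign X Z"
  by (simp add: ex_sign_def)

text \<open>Summing over \<open>h\<close> traces out the history. Amplitudes with different
  histories do not interfere, which is exactly the dephasing of \<open>il\<close>.\<close>

lemma run_eq_sum_hist:
  assumes "\<forall>s\<in>set ss. step_ok n d s" "a < d" "b < d"
  shows "run X d ss w0 a b = (\<Sum>h\<in>words (2 ^ n) (num_cl ss). hist X d ss w0 h a * cnj (hist X d ss w0 h b))"
  using assms
proof (induction ss arbitrary: a b rule: rev_induct)
  case Nil
  then show ?case by (simp add: run_Nil hist_Nil words_0)
next
  case (snoc s ss)
  let ?H = "words (2 ^ n) (num_cl ss)" and ?\<phi> = "hist X d ss w0"
  have IH: "run X d ss w0 a b = (\<Sum>h\<in>?H. ?\<phi> h a * cnj (?\<phi> h b))" if "a < d" "b < d" for a b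
    using snoc that by simp
  show ?case
  proof (cases s)
    case (Unitary U)
    have "(\<Sum>k<d. \<Sum>l<d. U a k * run X d ss w0 k l * cnj (U b l))
        = (\<Sum>k<d. \<Sum>l<d. \<Sum>h\<in>?H. U a k * ?\<phi> h k * (cnj (U b l) * cnj (?\<phi> h l)))"
      by (intro sum.cong refl) (simp add: IH sum_distrib_left sum_distrib_right mult_ac)
    also have "\<dots> = (\<Sum>k<d. \<Sum>h\<in>?H. \<Sum>l<d. U a k * ?\<phi> h k * (cnj (U b l) * cnj (?\<phi> h l)))"
      by (intro sum.cong refl sum.swap)
    also have "\<dots> = (\<Sum>h\<in>?H. \<Sum>k<d. \<Sum>l<d. U a k * ?\<phi> h k * (cnj (U b l) * cnj (?\<phi> h l)))"
      by (rule sum.swap)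
    also have "\<dots> = (\<Sum>h\<in>?H. (\<Sum>k<d. U a k * ?\<phi> h k) * cnj (\<Sum>l<d. U b l * ?\<phi> h l))"
      by (simp add: sum_product)
    finally show ?thesis by (simp add: Unitary run_snoc hist_snoc)
  next
    case (ExQuery zl)
    then show ?thesis
      by (simp add: run_snoc hist_snoc IH snoc.prems sum_distrib_left mult_ac)
  next
    case (ClQuery il fl)
    define g where "g w = (if il w \<in> X then fl w else w)" for w
    have ok: "il w < 2 ^ n" "g w < d" if "w < d" for w
      using snoc.prems that ClQuery by (auto simp: g_def)
    \<comment> \<open>The new history entry must equal both \<open>il a\<close> and
      \<open>il b\<close>, so entries with \<open>il a \<noteq> il b\<close> vanish.\<close>
    have "(\<Sum>h\<in>words (2 ^ n) (Suc (num_cl ss)). hist X d (ss @ [s]) w0 h a * cnj (hist X d (ss @ [s]) w0 h b))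
       = (\<Sum>h\<in>?H. \<Sum>i<2 ^ n. if i = il a then (if il a = il b then ?\<phi> h (g a) * cnj (?\<phi> h (g b)) else 0) else 0)"
      unfolding sum_words_Suc by (intro sum.cong refl) (simp add: ClQuery hist_snoc g_def)
    also have "\<dots> = (\<Sum>h\<in>?H. if il a = il b then ?\<phi> h (g a) * cnj (?\<phi> h (g b)) else 0)"
      using ok(1)[OF snoc.prems(2)] by simp
    also have "\<dots> = (if il a = il b then run X d ss w0 (g a) (g b) else 0)"
      using IH ok snoc.prems by simp
    also have "\<dots> = run X d (ss @ [s]) w0 a b"
      by (simp add: ClQuery run_snoc g_def)
    finally show ?thesis using ClQuery by simp
  qed
qed

lemma sum_norm_hist:
  assumes "\<forall>s\<in>set ss. step_ok n d s" "w0 < d"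
  shows "(\<Sum>h\<in>words (2 ^ n) (num_cl ss). \<Sum>w<d. hist X d ss w0 h w * cnj (hist X d ss w0 h w)) = 1"
  using assms
proof (induction ss rule: rev_induct)
  case Nil
  have "(\<Sum>w<d. (if w = w0 then 1 else 0) * cnj (if w = w0 then 1 else 0)) = (\<Sum>w<d. if w = w0 then 1 else (0 :: complex))"
    by (intro sum.cong) auto
  then show ?case using Nil by (simp add: hist_Nil words_0)
next
  case (snoc s ss)
  let ?H = "words (2 ^ n) (num_cl ss)" and ?\<phi> = "hist X d ss w0"
  have IH: "(\<Sum>h\<in>?H. \<Sum>w<d. ?\<phi> h w * cnj (?\<phi> h w)) = 1" using snoc by simp
  show ?case
  proof (cases s)
    case (Unitary U)
    then have "is_unitary d U" using snoc.prems by simp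
    then show ?thesis unfolding Unitary hist_snoc hist_step.simps num_cl_simps
      by (subst unitary_sum_mult_cnj) (auto simp: IH)
  next
    case (ExQuery zl)
    then show ?thesis using IH by (simp add: hist_snoc mult_ac)
  next
    case (ClQuery il fl)
    define g where "g w = (if il w \<in> X then fl w else w)" for w
    have ok: "il w < 2 ^ n" "g w < d" "g (g w) = w" if "w < d" for w
      using snoc.prems that ClQuery by (auto simp: g_def)
    \<comment> \<open>Since \<open>fl\<close> preserves \<open>il\<close>, flipping does not change
      the test \<open>il w \<in> X\<close>, so \<open>g\<close> is its own inverse.\<close>
    have bij: "bij_betw g {..<d} {..<d}"
      by (rule bij_betw_byWitness[of _ g]) (auto simp: ok)
    have "(\<Sum>h\<in>words (2 ^ n) (Suc (num_cl ss)). \<Sum>w<d. hist X d (ss @ [s]) w0 h w * cnj (hist X d (ss @ [s]) w0 h w))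
       = (\<Sum>h\<in>?H. \<Sum>i<2 ^ n. \<Sum>w<d. if i = il w then ?\<phi> h (g w) * cnj (?\<phi> h (g w)) else 0)"
      unfolding sum_words_Suc by (intro sum.cong refl) (simp add: ClQuery hist_snoc g_def)
    also have "\<dots> = (\<Sum>h\<in>?H. \<Sum>w<d. \<Sum>i<2 ^ n. if i = il w then ?\<phi> h (g w) * cnj (?\<phi> h (g w)) else 0)"
      by (intro sum.cong refl sum.swap)
    also have "\<dots> = (\<Sum>h\<in>?H. \<Sum>w<d. ?\<phi> h (g w) * cnj (?\<phi> h (g w)))"
      using ok(1) by (intro sum.cong) auto
    also have "\<dots> = (\<Sum>h\<in>?H. \<Sum>w<d. ?\<phi> h w * cnj (?\<phi> h w))"
      by (intro sum.cong refl sum.reindex_bij_betw[OF bij])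
    finally show ?thesis using IH ClQuery by simp
  qed
qed

section \<open>Truncated states and the effect of a single step\<close>

lemma Re_mult_cnj_self: "Re (z * cnj z) = (cmod z)\<^sup>2"
  unfolding cmod_power2 by (simp add: power2_eq_square)

text \<open>Dropping the branches in which a classical query has hit \<open>X\<close> amounts to letting the algorithm
 stop at its first success.\<close>

definition miss_amp :: "nat set \<Rightarrow> nat \<Rightarrow> step list \<Rightarrow> nat \<Rightarrow> nat list \<Rightarrow> nat \<Rightarrow> complex" where
  "miss_amp X d ss w0 h w = (if set h \<inter> X = {} then hist X d ss w0 h w else 0)"

text \<open>The progress measure of the adversary argument: real part of the inner product of the
  truncated purified states.\<close>

definition inner_amp :: "nat \<Rightarrow> nat \<Rightarrow> step list \<Rightarrow> nat \<Rightarrow> nat set \<Rightarrow> nat set \<Rightarrow> real" where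
  "inner_amp n d ss w0 X Y = (\<Sum>h\<in>words (2 ^ n) (num_cl ss). \<Sum>w<d.
     Re (miss_amp X d ss w0 h w * cnj (miss_amp Y d ss w0 h w)))"

text \<open>Used with \<open>X = Y\<close> for the mass that a classical query removes, and with
  independent inputs for accidental hits; \<open>f\<close> is a queried index or the output.\<close>

definition hit_mass :: "nat \<Rightarrow> nat \<Rightarrow> step list \<Rightarrow> nat \<Rightarrow> (nat \<Rightarrow> nat) \<Rightarrow> nat set \<Rightarrow> nat set \<Rightarrow> real" where
  "hit_mass n d ss w0 f X Y = (\<Sum>h\<in>words (2 ^ n) (num_cl ss). \<Sum>w<d.
     of_bool (f w \<in> X) * (cmod (miss_amp Y d ss w0 h w))\<^sup>2)"

lemma inner_amp_self: "inner_amp n d ss w0 X X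
    = (\<Sum>h\<in>words (2 ^ n) (num_cl ss). \<Sum>w<d. (cmod (miss_amp X d ss w0 h w))\<^sup>2)"
  by (simp only: inner_amp_def Re_mult_cnj_self)

lemma hit_mass_le: "hit_mass n d ss w0 f X Y \<le> inner_amp n d ss w0 Y Y"
  unfolding hit_mass_def inner_amp_self by (intro sum_mono) auto

lemma inner_amp_self_le_1:
  assumes "\<forall>s\<in>set ss. step_ok n d s" "w0 < d"
  shows "inner_amp n d ss w0 X X \<le> 1"
proof -
  have "inner_amp n d ss w0 X X
      \<le> (\<Sum>h\<in>words (2 ^ n) (num_cl ss). \<Sum>w<d. Re (hist X d ss w0 h w * cnj (hist X d ss w0 h w)))"
    unfolding inner_amp_def by (intro sum_mono) (auto simp: miss_amp_def)
  also have "\<dots> = 1"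
    using arg_cong[OF sum_norm_hist[OF assms], of Re] by (simp add: Re_sum)
  finally show ?thesis .
qed

lemma inner_amp_Nil: "w0 < d \<Longrightarrow> inner_amp n d [] w0 X Y = 1"
proof -
  assume "w0 < d"
  have "Re (miss_amp X d [] w0 [] w * cnj (miss_amp Y d [] w0 [] w)) = (if w = w0 then 1 else 0)" for w
    by (simp add: miss_amp_def hist_Nil)
  then have "inner_amp n d [] w0 X Y = (\<Sum>w<d. if w = w0 then 1 else 0)"
    unfolding inner_amp_def num_cl_simps words_0 by simp
  then show ?thesis using \<open>w0 < d\<close> by simp
qed

lemma inner_amp_Unitary:
  assumes "is_unitary d U"
  shows "inner_amp n d (ss @ [Unitary U]) w0 X Y = inner_amp n d ss w0 X Y"
proof -
  have "(\<Sum>w<d. miss_amp X d (ss @ [Unitary U]) w0 h w * cnj (miss_amp Y d (ss @ [Unitary U]) w0 h w))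
     = (\<Sum>w<d. miss_amp X d ss w0 h w * cnj (miss_amp Y d ss w0 h w))" for h
  proof -
    have "miss_amp Z d (ss @ [Unitary U]) w0 h w = (\<Sum>k<d. U w k * miss_amp Z d ss w0 h k)" for Z w
      by (simp add: miss_amp_def hist_snoc)
    then show ?thesis using unitary_sum_mult_cnj[OF assms] by simp
  qed
  then show ?thesis unfolding inner_amp_def Re_sum[symmetric] by simp
qed

lemma inner_amp_ExQuery:
  "inner_amp n d (ss @ [ExQuery zl]) w0 X Y = (\<Sum>h\<in>words (2 ^ n) (num_cl ss). \<Sum>w<d.
     Re (ex_sign X (zl w) * ex_sign Y (zl w) * (miss_amp X d ss w0 h w * cnj (miss_amp Y d ss w0 h w))))"
  unfolding inner_amp_def num_cl_simps
  by (intro sum.cong refl arg_cong[of _ _ Re]) (simp add: miss_amp_def hist_snoc)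

lemma inner_amp_self_ExQuery:
  "inner_amp n d (ss @ [ExQuery zl]) w0 X X = inner_amp n d ss w0 X X"
  unfolding inner_amp_ExQuery unfolding inner_amp_def by (simp only: mult.assoc ex_sign_mult_self)

text \<open>A hit enters the history and is cut off, so the flip \<open>fl\<close> never shows:
  surviving amplitudes are merely copied, with new history entry \<open>il w\<close>.\<close>

lemma inner_amp_ClQuery:
  assumes "step_ok n d (ClQuery il fl)"
  shows "inner_amp n d (ss @ [ClQuery il fl]) w0 X Y = (\<Sum>h\<in>words (2 ^ n) (num_cl ss). \<Sum>w<d.
     of_bool (il w \<notin> X \<and> il w \<notin> Y) * Re (miss_amp X d ss w0 h w * cnj (miss_amp Y d ss w0 h w)))"
proof -
  have step: "miss_amp Z d (ss @ [ClQuery il fl]) w0 (i # h) w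
      = (if il w = i \<and> i \<notin> Z then miss_amp Z d ss w0 h w else 0)" for Z i h w
    by (simp add: miss_amp_def hist_snoc)
  have "inner_amp n d (ss @ [ClQuery il fl]) w0 X Y = (\<Sum>h\<in>words (2 ^ n) (num_cl ss). \<Sum>i<2 ^ n. \<Sum>w<d.
     if i = il w then of_bool (il w \<notin> X \<and> il w \<notin> Y) * Re (miss_amp X d ss w0 h w * cnj (miss_amp Y d ss w0 h w)) else 0)"
    unfolding inner_amp_def num_cl_simps sum_words_Suc step by (intro sum.cong refl) auto
  also have "\<dots> = (\<Sum>h\<in>words (2 ^ n) (num_cl ss). \<Sum>w<d. \<Sum>i<2 ^ n.
     if i = il w then of_bool (il w \<notin> X \<and> il w \<notin> Y) * Re (miss_amp X d ss w0 h w * cnj (miss_amp Y d ss w0 h w)) else 0)"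
    by (intro sum.cong refl sum.swap)
  also have "\<dots> = (\<Sum>h\<in>words (2 ^ n) (num_cl ss). \<Sum>w<d.
     of_bool (il w \<notin> X \<and> il w \<notin> Y) * Re (miss_amp X d ss w0 h w * cnj (miss_amp Y d ss w0 h w)))"
    using assms by (intro sum.cong) auto
  finally show ?thesis .
qed

text \<open>The lost mass is tracked exactly because \<open>potential\<close> uses it to pay for
  lost overlap.\<close>

lemma inner_amp_self_ClQuery:
  assumes "step_ok n d (ClQuery il fl)"
  shows "inner_amp n d (ss @ [ClQuery il fl]) w0 X X = inner_amp n d ss w0 X X - hit_mass n d ss w0 il X X"
  unfolding inner_amp_ClQuery[OF assms] unfolding inner_amp_self hit_mass_def sum_subtractf[symmetric]
  by (intro sum.cong refl) (simp only: Re_mult_cnj_self, simp)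

lemma Re_mult_cnj_le: "\<bar>Re (x * cnj y)\<bar> \<le> cmod x * cmod y"
  using abs_Re_le_cmod[of "x * cnj y"] by (simp add: norm_mult)

lemma mult_le_weighted_squares:
  fixes x y :: real
  assumes "\<mu> > 0"
  shows "x * y \<le> \<mu> / 2 * x\<^sup>2 + y\<^sup>2 / (2 * \<mu>)"
proof -
  have "0 \<le> (\<mu> * x - y)\<^sup>2" by simp
  then have "2 * \<mu> * (x * y) \<le> (\<mu> * x)\<^sup>2 + y\<^sup>2" by (simp add: power2_eq_square algebra_simps)
  then show ?thesis using assms by (simp add: field_simps power2_eq_square)
qed

text \<open>The overlap lost when \<open>f\<close> hits \<open>X\<close> is charged to the mass that leaves the branch of \<open>X\<close>, which
 sums to at most 1 over all queries, and to the mass of hits of \<open>X\<close> in the run on an independent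
 \<open>Y\<close>, which is tiny on average.\<close>

lemma sum_hit_le:
  assumes "\<mu> > 0"
  shows "(\<Sum>h\<in>words (2 ^ n) (num_cl ss). \<Sum>w<d.
      of_bool (f w \<in> X) * (cmod (miss_amp X d ss w0 h w) * cmod (miss_amp Y d ss w0 h w)))
    \<le> \<mu> / 2 * hit_mass n d ss w0 f X X + hit_mass n d ss w0 f X Y / (2 * \<mu>)"
proof -
  have "(\<Sum>h\<in>words (2 ^ n) (num_cl ss). \<Sum>w<d.
      of_bool (f w \<in> X) * (cmod (miss_amp X d ss w0 h w) * cmod (miss_amp Y d ss w0 h w)))
    \<le> (\<Sum>h\<in>words (2 ^ n) (num_cl ss). \<Sum>w<d.
      \<mu> / 2 * (of_bool (f w \<in> X) * (cmod (miss_amp X d ss w0 h w))\<^sup>2)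
      + of_bool (f w \<in> X) * (cmod (miss_amp Y d ss w0 h w))\<^sup>2 / (2 * \<mu>))"
    using mult_le_weighted_squares[OF assms] by (intro sum_mono) auto
  then show ?thesis
    by (simp only: hit_mass_def sum.distrib sum_distrib_left sum_divide_distrib)
qed

lemma inner_amp_ClQuery_ge:
  assumes ok: "step_ok n d (ClQuery il fl)" and "\<mu> > 0"
  shows "inner_amp n d (ss @ [ClQuery il fl]) w0 X Y \<ge> inner_amp n d ss w0 X Y
     - (\<mu> / 2 * hit_mass n d ss w0 il X X + hit_mass n d ss w0 il X Y / (2 * \<mu>))
     - (\<mu> / 2 * hit_mass n d ss w0 il Y Y + hit_mass n d ss w0 il Y X / (2 * \<mu>))"
proof -
  let ?p = "\<lambda>h w. cmod (miss_amp X d ss w0 h w) * cmod (miss_amp Y d ss w0 h w)"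
  have "inner_amp n d ss w0 X Y - inner_amp n d (ss @ [ClQuery il fl]) w0 X Y
     \<le> (\<Sum>h\<in>words (2 ^ n) (num_cl ss). \<Sum>w<d. of_bool (il w \<in> X) * ?p h w + of_bool (il w \<in> Y) * ?p h w)"
    unfolding inner_amp_ClQuery[OF ok] unfolding inner_amp_def sum_subtractf[symmetric]
  proof (intro sum_mono)
    fix h w
    define z where "z = miss_amp X d ss w0 h w * cnj (miss_amp Y d ss w0 h w)"
    have "\<bar>Re z\<bar> \<le> ?p h w" unfolding z_def by (rule Re_mult_cnj_le)
    then show "Re (miss_amp X d ss w0 h w * cnj (miss_amp Y d ss w0 h w))
        - of_bool (il w \<notin> X \<and> il w \<notin> Y) * Re (miss_amp X d ss w0 h w * cnj (miss_amp Y d ss w0 h w))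
      \<le> of_bool (il w \<in> X) * ?p h w + of_bool (il w \<in> Y) * ?p h w"
      unfolding z_def[symmetric] by (cases "il w \<in> X"; cases "il w \<in> Y") auto
  qed
  also have "\<dots> = (\<Sum>h\<in>words (2 ^ n) (num_cl ss). \<Sum>w<d. of_bool (il w \<in> X) * ?p h w)
      + (\<Sum>h\<in>words (2 ^ n) (num_cl ss). \<Sum>w<d.
          of_bool (il w \<in> Y) * (cmod (miss_amp Y d ss w0 h w) * cmod (miss_amp X d ss w0 h w)))"
    by (simp add: sum.distrib mult_ac)
  finally show ?thesis
    using sum_hit_le[OF \<open>\<mu> > 0\<close>, where f = il and X = X and Y = Y and n = n and ss = ss and d = d and ?w0.0 = w0] sum_hit_le[OF \<open>\<mu> > 0\<close>, where f = il and X = Y and Y = X and n = n and ss = ss and d = d and ?w0.0 = w0] by linarith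
qed

text \<open>Covers one of the two ways in which the phases for \<open>X\<close> and \<open>Y\<close>
  can differ; fixing which input is hit gives the form that \<open>pavg_hit_miss_le\<close>
  bounds.\<close>

definition ex_loss :: "nat \<Rightarrow> nat \<Rightarrow> step list \<Rightarrow> nat \<Rightarrow> (nat \<Rightarrow> nat set) \<Rightarrow> nat set \<Rightarrow> nat set \<Rightarrow> real" where
  "ex_loss n d ss w0 zl X Y = (\<Sum>h\<in>words (2 ^ n) (num_cl ss). \<Sum>w<d.
     of_bool (overlap X (zl w) \<and> \<not> overlap Y (zl w))
       * (cmod (miss_amp X d ss w0 h w) * cmod (miss_amp Y d ss w0 h w)))"

text \<open>A term changes only if exactly one input overlaps the queried set. Its sign then flips,
  which costs at most twice the product of the moduli.\<close>

lemma inner_amp_ExQuery_ge: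
  "inner_amp n d (ss @ [ExQuery zl]) w0 X Y
     \<ge> inner_amp n d ss w0 X Y - 2 * ex_loss n d ss w0 zl X Y - 2 * ex_loss n d ss w0 zl Y X"
proof -
  have "inner_amp n d ss w0 X Y - inner_amp n d (ss @ [ExQuery zl]) w0 X Y
      \<le> (\<Sum>h\<in>words (2 ^ n) (num_cl ss). \<Sum>w<d.
          2 * (of_bool (overlap X (zl w) \<and> \<not> overlap Y (zl w))
            * (cmod (miss_amp X d ss w0 h w) * cmod (miss_amp Y d ss w0 h w)))
        + 2 * (of_bool (overlap Y (zl w) \<and> \<not> overlap X (zl w))
            * (cmod (miss_amp Y d ss w0 h w) * cmod (miss_amp X d ss w0 h w))))"
    unfolding inner_amp_ExQuery unfolding inner_amp_def sum_subtractf[symmetric]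
  proof (intro sum_mono)
    fix h w
    define z where "z = miss_amp X d ss w0 h w * cnj (miss_amp Y d ss w0 h w)"
    have z: "\<bar>Re z\<bar> \<le> cmod (miss_amp X d ss w0 h w) * cmod (miss_amp Y d ss w0 h w)"
      unfolding z_def by (rule Re_mult_cnj_le)
    then show "Re (miss_amp X d ss w0 h w * cnj (miss_amp Y d ss w0 h w))
        - Re (ex_sign X (zl w) * ex_sign Y (zl w) * (miss_amp X d ss w0 h w * cnj (miss_amp Y d ss w0 h w)))
      \<le> 2 * (of_bool (overlap X (zl w) \<and> \<not> overlap Y (zl w))
            * (cmod (miss_amp X d ss w0 h w) * cmod (miss_amp Y d ss w0 h w)))
        + 2 * (of_bool (overlap Y (zl w) \<and> \<not> overlap X (zl w))
            * (cmod (miss_amp Y d ss w0 h w) * cmod (miss_amp X d ss w0 h w)))"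
      unfolding z_def[symmetric]
      by (cases "overlap X (zl w)"; cases "overlap Y (zl w)") (auto simp: ex_sign_def mult.commute)
  qed
  also have "\<dots> = 2 * ex_loss n d ss w0 zl X Y + 2 * ex_loss n d ss w0 zl Y X"
    by (simp only: ex_loss_def sum.distrib sum_distrib_left)
  finally show ?thesis by linarith
qed

text \<open>Outputs outside \<open>X\<close> carry mass at most \<open>1 - p\<close> in the run on
  \<open>X\<close> and at most 1 in the run on \<open>Y\<close>, so AM-GM gives
  \<open>(1 - p) / 2 + 1 / 2 = 1 - p / 2\<close>. Outputs in \<open>X\<close> are charged by
  \<open>sum_hit_le\<close> to their mass in the run on \<open>Y\<close>.\<close>

lemma inner_amp_final_le:
  assumes ok: "\<forall>s\<in>set ss. step_ok n d s" "w0 < d" and "\<mu> > 0"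
    and success: "p \<le> success_prob X d ss w0 ol"
  shows "inner_amp n d ss w0 X Y \<le> \<mu> / 2 + hit_mass n d ss w0 ol X Y / (2 * \<mu>) + (1 - p / 2)"
proof -
  let ?H = "words (2 ^ n) (num_cl ss)"
  let ?x = "\<lambda>h w. cmod (miss_amp X d ss w0 h w)" and ?y = "\<lambda>h w. cmod (miss_amp Y d ss w0 h w)"
  have miss: "(\<Sum>h\<in>?H. \<Sum>w<d. of_bool (ol w \<notin> X) * (?x h w)\<^sup>2) \<le> 1 - p"
  proof -
    let ?q = "\<lambda>h w. (cmod (hist X d ss w0 h w))\<^sup>2"
    have q: "Re (hist X d ss w0 h w * cnj (hist X d ss w0 h w)) = ?q h w" for h w
      by (rule Re_mult_cnj_self)
    have "Re (run X d ss w0 w w) = (\<Sum>h\<in>?H. ?q h w)" if "w < d" for w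
      using run_eq_sum_hist[OF ok(1) that that, of X w0] by (simp only: Re_sum q)
    then have "success_prob X d ss w0 ol = (\<Sum>w<d. \<Sum>h\<in>?H. of_bool (ol w \<in> X) * ?q h w)"
      unfolding success_prob_def by (intro sum.cong) auto
    also have "\<dots> = (\<Sum>h\<in>?H. \<Sum>w<d. of_bool (ol w \<in> X) * ?q h w)" by (rule sum.swap)
    finally have "success_prob X d ss w0 ol + (\<Sum>h\<in>?H. \<Sum>w<d. of_bool (ol w \<notin> X) * ?q h w)
        = (\<Sum>h\<in>?H. \<Sum>w<d. of_bool (ol w \<in> X) * ?q h w + of_bool (ol w \<notin> X) * ?q h w)"
      by (simp only: sum.distrib)
    also have "\<dots> = (\<Sum>h\<in>?H. \<Sum>w<d. ?q h w)" by (intro sum.cong refl) auto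
    also have "\<dots> = 1"
      using arg_cong[OF sum_norm_hist[OF ok, of X], of Re] by (simp only: Re_sum q one_complex.sel)
    finally have "(\<Sum>h\<in>?H. \<Sum>w<d. of_bool (ol w \<notin> X) * ?q h w) \<le> 1 - p" using success by linarith
    \<comment> \<open>Truncation only discards amplitudes, so it cannot increase the failure
      mass.\<close>
    moreover have "(\<Sum>h\<in>?H. \<Sum>w<d. of_bool (ol w \<notin> X) * (?x h w)\<^sup>2)
        \<le> (\<Sum>h\<in>?H. \<Sum>w<d. of_bool (ol w \<notin> X) * ?q h w)"
      by (intro sum_mono mult_left_mono) (auto simp: miss_amp_def)
    ultimately show ?thesis by linarith
  qed
  have "inner_amp n d ss w0 X Y \<le> (\<Sum>h\<in>?H. \<Sum>w<d. of_bool (ol w \<in> X) * (?x h w * ?y h w)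
      + (of_bool (ol w \<notin> X) * (?x h w)\<^sup>2 / 2 + (?y h w)\<^sup>2 / 2))"
    unfolding inner_amp_def
  proof (intro sum_mono)
    fix h w
    have "Re (miss_amp X d ss w0 h w * cnj (miss_amp Y d ss w0 h w)) \<le> ?x h w * ?y h w"
      using Re_mult_cnj_le[of "miss_amp X d ss w0 h w" "miss_amp Y d ss w0 h w"] by linarith
    also have "\<dots> \<le> of_bool (ol w \<in> X) * (?x h w * ?y h w)
      + (of_bool (ol w \<notin> X) * (?x h w)\<^sup>2 / 2 + (?y h w)\<^sup>2 / 2)"
      using mult_le_weighted_squares[of 1 "?x h w" "?y h w"] by (cases "ol w \<in> X") auto
    finally show "Re (miss_amp X d ss w0 h w * cnj (miss_amp Y d ss w0 h w))
        \<le> of_bool (ol w \<in> X) * (?x h w * ?y h w) + (of_bool (ol w \<notin> X) * (?x h w)\<^sup>2 / 2 + (?y h w)\<^sup>2 / 2)" .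
  qed
  also have "\<dots> = (\<Sum>h\<in>?H. \<Sum>w<d. of_bool (ol w \<in> X) * (?x h w * ?y h w))
      + ((\<Sum>h\<in>?H. \<Sum>w<d. of_bool (ol w \<notin> X) * (?x h w)\<^sup>2) / 2 + inner_amp n d ss w0 Y Y / 2)"
    by (simp only: sum.distrib sum_divide_distrib inner_amp_self)
  finally have 1: "inner_amp n d ss w0 X Y \<le> (\<Sum>h\<in>?H. \<Sum>w<d. of_bool (ol w \<in> X) * (?x h w * ?y h w))
      + ((\<Sum>h\<in>?H. \<Sum>w<d. of_bool (ol w \<notin> X) * (?x h w)\<^sup>2) / 2 + inner_amp n d ss w0 Y Y / 2)" .
  have "hit_mass n d ss w0 ol X X \<le> 1"
    using hit_mass_le inner_amp_self_le_1[OF ok] by (rule order_trans)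
  then have "\<mu> / 2 * hit_mass n d ss w0 ol X X \<le> \<mu> / 2 * 1"
    using \<open>\<mu> > 0\<close> by (intro mult_left_mono) auto
  then show ?thesis
    using 1 miss sum_hit_le[OF \<open>\<mu> > 0\<close>, where f = ol and X = X and Y = Y and n = n and ss = ss and d = d and ?w0.0 = w0] inner_amp_self_le_1[OF ok, of Y] by argo
qed

section \<open>Losses averaged over random inputs\<close>

lemma avg_hit_mass_le:
  assumes ok: "\<forall>s\<in>set ss. step_ok n d s" "w0 < d" and a: "a < n div 2"
  shows "avg (2 ^ n) (2 ^ a) (\<lambda>X. hit_mass n d ss w0 f X Y) \<le> 1 / 2 ^ (n div 2)"
proof -
  have mem: "avg (2 ^ n) (2 ^ a) (\<lambda>X. of_bool (i \<in> X)) \<le> 1 / 2 ^ (n div 2)" for i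
  proof (cases "i < 2 ^ n")
    case True
    have "avg (2 ^ n) (2 ^ a) (\<lambda>X. of_bool (i \<in> X)) \<le> 2 ^ a / 2 ^ n"
      using avg_mem_le[OF True, of "2 ^ a"] by simp
    also have "\<dots> \<le> 1 / 2 ^ (n div 2)"
    proof -
      \<comment> \<open>This is why only scales below \<open>n div 2\<close> are used: a fixed index
        is then hit with exponentially small probability.\<close>
      have "(2 :: real) ^ (a + n div 2) \<le> 2 ^ n" using a by (intro power_increasing) auto
      then show ?thesis by (simp add: field_simps power_add)
    qed
    finally show ?thesis .
  next
    case False
    \<comment> \<open>Output labels are unrestricted, but a label outside \<open>{..<2 ^ n}\<close>
      is never in a random input.\<close>
    then have "avg (2 ^ n) (2 ^ a) (\<lambda>X. of_bool (i \<in> X)) \<le> avg (2 ^ n) (2 ^ a) (\<lambda>_. 0)"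
      by (intro avg_mono) auto
    also have "\<dots> \<le> 1 / 2 ^ (n div 2)" by (simp add: avg_const)
    finally show ?thesis .
  qed
  have "avg (2 ^ n) (2 ^ a) (\<lambda>X. hit_mass n d ss w0 f X Y) = (\<Sum>h\<in>words (2 ^ n) (num_cl ss). \<Sum>w<d.
     (cmod (miss_amp Y d ss w0 h w))\<^sup>2 * avg (2 ^ n) (2 ^ a) (\<lambda>X. of_bool (f w \<in> X)))"
    unfolding hit_mass_def avg_sum avg_cmult[symmetric] by (simp only: mult.commute)
  also have "\<dots> \<le> (\<Sum>h\<in>words (2 ^ n) (num_cl ss). \<Sum>w<d.
     (cmod (miss_amp Y d ss w0 h w))\<^sup>2 * (1 / 2 ^ (n div 2)))"
    by (intro sum_mono mult_left_mono mem) auto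
  also have "\<dots> = inner_amp n d ss w0 Y Y * (1 / 2 ^ (n div 2))"
    by (simp only: inner_amp_self sum_distrib_right)
  also have "\<dots> \<le> 1 * (1 / 2 ^ (n div 2))"
    by (intro mult_right_mono inner_amp_self_le_1 ok) auto
  finally show ?thesis by simp
qed

text \<open>Exchanging the arguments makes the hit input \<open>X\<close> innermost, so that the
  bound for fixed \<open>Y\<close> applies.\<close>

lemma pavg_hit_mass_le:
  assumes ok: "\<forall>s\<in>set ss. step_ok n d s" "w0 < d"
  shows "pavg (2 ^ n) (n div 2) (\<lambda>X Y. hit_mass n d ss w0 f X Y) \<le> hilbert_weight (n div 2) / 2 ^ (n div 2)"
proof -
  have "pavg (2 ^ n) (n div 2) (\<lambda>Y X. hit_mass n d ss w0 f X Y) \<le> hilbert_weight (n div 2) * (1 / 2 ^ (n div 2))"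
    by (intro pavg_le_inner avg_hit_mass_le ok) auto
  then show ?thesis by (subst pavg_swap[symmetric]) simp
qed

text \<open>\<open>pavg_hit_miss_le\<close> is applied to each history and basis state separately.
  The second moments then add up to a mass of at most 1 per scale, so neither \<open>d\<close> nor
  the number of histories enters the bound.\<close>

lemma pavg_ex_loss_le:
  assumes ok: "\<forall>s\<in>set ss. step_ok n d s" "w0 < d" and zl: "step_ok n d (ExQuery zl)"
  shows "pavg (2 ^ n) L (\<lambda>X Y. ex_loss n d ss w0 zl X Y) \<le> 48 * real L"
proof -
  have "pavg (2 ^ n) L (\<lambda>X Y. ex_loss n d ss w0 zl X Y)
     = (\<Sum>h\<in>words (2 ^ n) (num_cl ss). \<Sum>w<d. pavg (2 ^ n) L (\<lambda>X Y.
       of_bool (overlap X (zl w) \<and> \<not> overlap Y (zl w)) * (cmod (miss_amp X d ss w0 h w) * cmod (miss_amp Y d ss w0 h w))))"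
    by (simp only: ex_loss_def pavg_sum)
  also have "\<dots> \<le> (\<Sum>h\<in>words (2 ^ n) (num_cl ss). \<Sum>w<d.
      48 * (\<Sum>a<L. avg (2 ^ n) (2 ^ a) (\<lambda>X. (cmod (miss_amp X d ss w0 h w))\<^sup>2)))"
    using zl by (intro sum_mono pavg_hit_miss_le) auto
  also have "\<dots> = 48 * (\<Sum>h\<in>words (2 ^ n) (num_cl ss). \<Sum>w<d. \<Sum>a<L. avg (2 ^ n) (2 ^ a) (\<lambda>X. (cmod (miss_amp X d ss w0 h w))\<^sup>2))"
    by (simp only: sum_distrib_left)
  also have "(\<Sum>h\<in>words (2 ^ n) (num_cl ss). \<Sum>w<d. \<Sum>a<L. avg (2 ^ n) (2 ^ a) (\<lambda>X. (cmod (miss_amp X d ss w0 h w))\<^sup>2))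
      = (\<Sum>h\<in>words (2 ^ n) (num_cl ss). \<Sum>a<L. \<Sum>w<d. avg (2 ^ n) (2 ^ a) (\<lambda>X. (cmod (miss_amp X d ss w0 h w))\<^sup>2))"
    by (intro sum.cong refl sum.swap)
  also have "\<dots> = (\<Sum>a<L. \<Sum>h\<in>words (2 ^ n) (num_cl ss). \<Sum>w<d. avg (2 ^ n) (2 ^ a) (\<lambda>X. (cmod (miss_amp X d ss w0 h w))\<^sup>2))"
    by (rule sum.swap)
  also have "\<dots> = (\<Sum>a<L. avg (2 ^ n) (2 ^ a) (\<lambda>X. inner_amp n d ss w0 X X))"
    by (simp only: inner_amp_self avg_sum)
  also have "\<dots> \<le> (\<Sum>a<L. avg (2 ^ n) (2 ^ a) (\<lambda>X. 1))"
    by (intro sum_mono avg_mono inner_amp_self_le_1 ok)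
  also have "\<dots> = real L" by (simp add: avg_const)
  finally show ?thesis by simp
qed

section \<open>The potential argument\<close>

text \<open>The mass terms are compensators: a classical query shrinks the truncated masses, and
  this gain cancels the \<open>\<mu> / 2\<close> share of the loss in
  \<open>inner_amp_ClQuery_ge\<close>.\<close>

definition potential :: "nat \<Rightarrow> nat \<Rightarrow> step list \<Rightarrow> nat \<Rightarrow> real \<Rightarrow> real" where
  "potential n d ss w0 \<mu> = pavg (2 ^ n) (n div 2) (\<lambda>X Y. inner_amp n d ss w0 X Y
     - \<mu> / 2 * (inner_amp n d ss w0 X X + inner_amp n d ss w0 Y Y))"

text \<open>The integrand starts at \<open>1 - \<mu>\<close> for every pair. A classical query costs
  only accidental hits; an existential query costs four times the bound \<open>48 * L\<close> with
  \<open>L = n div 2\<close>, hence \<open>192\<close>.\<close>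

lemma potential_ge:
  assumes ok: "\<forall>s\<in>set ss. step_ok n d s" "w0 < d" and "\<mu> > 0"
  shows "potential n d ss w0 \<mu> \<ge> hilbert_weight (n div 2) * (1 - \<mu>)
    - real (num_cl ss) * (hilbert_weight (n div 2) / 2 ^ (n div 2) / \<mu>)
    - real (num_ex ss) * (192 * real (n div 2))"
  using ok(1)
proof (induction ss rule: rev_induct)
  case Nil
  show ?case using ok by (simp add: potential_def inner_amp_Nil pavg_const)
next
  case (snoc s ss)
  have okss: "\<forall>s\<in>set ss. step_ok n d s" using snoc.prems by simp
  let ?P = "\<lambda>ss X Y. inner_amp n d ss w0 X Y - \<mu> / 2 * (inner_amp n d ss w0 X X + inner_amp n d ss w0 Y Y)"
  note IH = snoc.IH[OF okss]
  show ?case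
  proof (cases s)
    case (Unitary U)
    then show ?thesis using IH snoc.prems by (simp add: potential_def inner_amp_Unitary)
  next
    case (ExQuery zl)
    let ?l = "\<lambda>X Y. ex_loss n d ss w0 zl X Y"
    have "pavg (2 ^ n) (n div 2) (\<lambda>X Y. ?P ss X Y + (- 2 * ?l X Y + - 2 * ?l Y X)) \<le> potential n d (ss @ [s]) w0 \<mu>"
      unfolding potential_def ExQuery inner_amp_self_ExQuery
    proof (rule pavg_mono)
      fix X Y
      show "?P ss X Y + (- 2 * ?l X Y + - 2 * ?l Y X) \<le> inner_amp n d (ss @ [ExQuery zl]) w0 X Y
          - \<mu> / 2 * (inner_amp n d ss w0 X X + inner_amp n d ss w0 Y Y)"
        using inner_amp_ExQuery_ge[of n d ss w0 X Y zl] by linarith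
    qed
    moreover have "pavg (2 ^ n) (n div 2) (\<lambda>X Y. ?P ss X Y + (- 2 * ?l X Y + - 2 * ?l Y X))
        = potential n d ss w0 \<mu> + (- 2 * pavg (2 ^ n) (n div 2) ?l + - 2 * pavg (2 ^ n) (n div 2) ?l)"
      unfolding potential_def pavg_add pavg_cmult pavg_swap[of _ _ ?l] ..
    moreover have "pavg (2 ^ n) (n div 2) ?l \<le> 48 * real (n div 2)"
      using snoc.prems ExQuery by (intro pavg_ex_loss_le okss ok(2)) auto
    ultimately show ?thesis using IH by (simp add: ExQuery algebra_simps)
  next
    case (ClQuery il fl)
    then have okc: "step_ok n d (ClQuery il fl)" using snoc.prems by simp
    let ?q = "\<lambda>X Y. hit_mass n d ss w0 il X Y"
    define c where "c = - 1 / (2 * \<mu>)"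
    have "pavg (2 ^ n) (n div 2) (\<lambda>X Y. ?P ss X Y + (c * ?q X Y + c * ?q Y X)) \<le> potential n d (ss @ [s]) w0 \<mu>"
      unfolding potential_def ClQuery inner_amp_self_ClQuery[OF okc]
    proof (rule pavg_mono)
      fix X Y
      \<comment> \<open>The \<open>\<mu> / 2\<close> multiples of \<open>?q X X\<close> and
        \<open>?q Y Y\<close> cancel; only the cross terms with coefficient \<open>c\<close>
        remain.\<close>
      have "c * ?q X Y = - (?q X Y / (2 * \<mu>))" "c * ?q Y X = - (?q Y X / (2 * \<mu>))"
        by (simp_all add: c_def)
      then show "?P ss X Y + (c * ?q X Y + c * ?q Y X) \<le> inner_amp n d (ss @ [ClQuery il fl]) w0 X Y
          - \<mu> / 2 * (inner_amp n d ss w0 X X - ?q X X + (inner_amp n d ss w0 Y Y - ?q Y Y))"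
        using inner_amp_ClQuery_ge[OF okc \<open>\<mu> > 0\<close>, of ss w0 X Y] by (simp add: algebra_simps)
    qed
    moreover have "pavg (2 ^ n) (n div 2) (\<lambda>X Y. ?P ss X Y + (c * ?q X Y + c * ?q Y X))
        = potential n d ss w0 \<mu> + (c * pavg (2 ^ n) (n div 2) ?q + c * pavg (2 ^ n) (n div 2) ?q)"
      unfolding potential_def pavg_add pavg_cmult pavg_swap[of _ _ ?q] ..
    moreover have "pavg (2 ^ n) (n div 2) ?q / \<mu> \<le> hilbert_weight (n div 2) / 2 ^ (n div 2) / \<mu>"
      using \<open>\<mu> > 0\<close> by (intro divide_right_mono pavg_hit_mass_le okss ok(2)) auto
    moreover have "c * pavg (2 ^ n) (n div 2) ?q + c * pavg (2 ^ n) (n div 2) ?q = - (pavg (2 ^ n) (n div 2) ?q / \<mu>)"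
      by (simp add: c_def)
    ultimately show ?thesis using IH unfolding ClQuery num_cl_simps num_ex_simps of_nat_Suc distrib_right by linarith
  qed
qed

text \<open>The lower bound on the final potential meets the upper bound forced by success. In
  \<open>3 * \<mu> / 2\<close>, one \<open>\<mu>\<close> comes from the initial value and
  \<open>\<mu> / 2\<close> from the final overlap.\<close>

lemma num_ex_ge:
  assumes ok: "\<forall>s\<in>set ss. step_ok n d s" "w0 < d" and "\<mu> > 0"
    and success: "\<And>X. X \<subseteq> {..<2 ^ n} \<Longrightarrow> X \<noteq> {} \<Longrightarrow> p \<le> success_prob X d ss w0 ol"
  shows "hilbert_weight (n div 2) * (p / 2 - 3 * \<mu> / 2 - (real (num_cl ss) + 1) / (2 ^ (n div 2) * \<mu>))
    \<le> real (num_ex ss) * (192 * real (n div 2))"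
proof -
  let ?W = "hilbert_weight (n div 2)" and ?q = "\<lambda>X Y. hit_mass n d ss w0 ol X Y"
  have "potential n d ss w0 \<mu> \<le> pavg (2 ^ n) (n div 2) (\<lambda>X Y. (\<mu> / 2 + (1 - p / 2)) + 1 / (2 * \<mu>) * ?q X Y)"
    unfolding potential_def
  proof (rule pavg_mono)
    fix X Y :: "nat set" assume X: "X \<subseteq> {..<2 ^ n}" "X \<noteq> {}"
    have "0 \<le> inner_amp n d ss w0 Z Z" for Z
      unfolding inner_amp_self by (intro sum_nonneg) auto
    then have "0 \<le> \<mu> / 2 * (inner_amp n d ss w0 X X + inner_amp n d ss w0 Y Y)"
      using \<open>\<mu> > 0\<close> by simp
    then show "inner_amp n d ss w0 X Y - \<mu> / 2 * (inner_amp n d ss w0 X X + inner_amp n d ss w0 Y Y)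
        \<le> (\<mu> / 2 + (1 - p / 2)) + 1 / (2 * \<mu>) * ?q X Y"
      using inner_amp_final_le[OF ok \<open>\<mu> > 0\<close> success[OF X], of Y] by simp
  qed
  also have "\<dots> = ?W * (\<mu> / 2 + (1 - p / 2)) + 1 / (2 * \<mu>) * pavg (2 ^ n) (n div 2) ?q"
    by (simp only: pavg_add pavg_cmult) (simp add: pavg_const distrib_left)
  also have "1 / (2 * \<mu>) * pavg (2 ^ n) (n div 2) ?q \<le> 1 / (2 * \<mu>) * (?W / 2 ^ (n div 2))"
    using \<open>\<mu> > 0\<close> by (intro mult_left_mono pavg_hit_mass_le ok) auto
  \<comment> \<open>After doubling, the output costs as much as one classical query, hence
    \<open>num_cl ss + 1\<close>.\<close>
  also have "1 / (2 * \<mu>) * (?W / 2 ^ (n div 2)) \<le> 1 / \<mu> * (?W / 2 ^ (n div 2))"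
    using \<open>\<mu> > 0\<close> by (intro mult_right_mono) (auto simp: field_simps hilbert_weight_def intro!: sum_nonneg)
  finally have "potential n d ss w0 \<mu> \<le> ?W * (\<mu> / 2 + (1 - p / 2)) + 1 / \<mu> * (?W / 2 ^ (n div 2))"
    by simp
  moreover have "?W * (p / 2 - 3 * \<mu> / 2 - (real (num_cl ss) + 1) / (2 ^ (n div 2) * \<mu>))
      = ?W * (1 - \<mu>) - real (num_cl ss) * (?W / 2 ^ (n div 2) / \<mu>)
        - (?W * (\<mu> / 2 + (1 - p / 2)) + 1 / \<mu> * (?W / 2 ^ (n div 2)))"
    using \<open>\<mu> > 0\<close> by (simp add: field_simps)
  ultimately show ?thesis using potential_ge[OF ok \<open>\<mu> > 0\<close>] by linarith
qed

section \<open>Asymptotics and choice of constants\<close>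

lemma poly_over_power2_tendsto_0:
  fixes c :: real
  shows "(\<lambda>n. (c * real n ^ k + 1) / 2 ^ (n div 2)) \<longlonglongrightarrow> 0"
proof -
  \<comment> \<open>Here \<open>m\<close> stands for \<open>n div 2\<close>, with
    \<open>n \<le> 2 * m + 1\<close>; the absolute value covers negative \<open>c\<close>.\<close>
  have "(\<lambda>m. (\<bar>c\<bar> * (2 * real m + 1) ^ k + 1) / 2 ^ m) \<longlonglongrightarrow> 0"
    by real_asymp
  moreover have "filterlim (\<lambda>n::nat. n div 2) at_top at_top"
    unfolding filterlim_at_top eventually_sequentially
  proof
    fix Z :: nat
    show "\<exists>N. \<forall>n\<ge>N. Z \<le> n div 2" by (intro exI[of _ "2 * Z"]) auto
  qed
  ultimately have "(\<lambda>n. (\<bar>c\<bar> * (2 * real (n div 2) + 1) ^ k + 1) / 2 ^ (n div 2)) \<longlonglongrightarrow> 0"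
    by (rule filterlim_compose)
  then show ?thesis
  proof (rule Lim_null_comparison[rotated])
    have "\<bar>c * real n ^ k + 1\<bar> \<le> \<bar>c\<bar> * (2 * real (n div 2) + 1) ^ k + 1" for n
    proof -
      have "real n \<le> 2 * real (n div 2) + 1" by linarith
      then have "\<bar>c\<bar> * real n ^ k \<le> \<bar>c\<bar> * (2 * real (n div 2) + 1) ^ k"
        by (intro mult_left_mono power_mono) auto
      moreover have "\<bar>c * real n ^ k + 1\<bar> \<le> \<bar>c\<bar> * real n ^ k + 1"
        using abs_triangle_ineq[of "c * real n ^ k" 1] by (simp add: abs_mult)
      ultimately show ?thesis by linarith
    qed
    then show "\<forall>\<^sub>F n in sequentially. norm ((c * real n ^ k + 1) / 2 ^ (n div 2))
        \<le> (\<bar>c\<bar> * (2 * real (n div 2) + 1) ^ k + 1) / 2 ^ (n div 2)"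
      by (intro always_eventually allI) (simp add: divide_right_mono)
  qed
qed

theorem theorem2:
  fixes p c :: real and k :: nat
  assumes "p > 0"
  shows "\<exists>\<delta>>0. \<exists>n0::nat. \<forall>n\<ge>n0. \<forall>d w0 ss ol.
           w0 < d \<and> (\<forall>s\<in>set ss. step_ok n d s) \<and> real (num_cl ss) \<le> c * real n ^ k \<and>
           (\<forall>X. X \<subseteq> {..<2^n} \<and> X \<noteq> {} \<longrightarrow> success_prob X d ss w0 ol \<ge> p)
           \<longrightarrow> real (num_ex ss) \<ge> \<delta> * ln (real n)"
proof -
  \<comment> \<open>Then \<open>3 * \<mu> / 2 = p / 8\<close>. The classical queries and the output
    take at most another \<open>p / 8\<close> for large \<open>n\<close>, which leaves
    \<open>p / 4\<close> of \<open>p / 2\<close>.\<close>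
  define \<mu> where "\<mu> = p / 12"
  have \<mu>: "\<mu> > 0" using assms by (simp add: \<mu>_def)
  have "\<forall>\<^sub>F n in sequentially. (c * real n ^ k + 1) / 2 ^ (n div 2) < \<mu> * p / 8"
    using poly_over_power2_tendsto_0 by (rule order_tendstoD(2)) (use \<mu> assms in simp)
  then obtain n1 where n1: "(c * real n ^ k + 1) / 2 ^ (n div 2) < \<mu> * p / 8" if "n \<ge> n1" for n
    by (auto simp: eventually_sequentially)
  have bound: "p / 3072 * ln (real n) \<le> real (num_ex ss)"
    if n: "n \<ge> max n1 18" and "w0 < d" and ok: "\<forall>s\<in>set ss. step_ok n d s"
      and cl: "real (num_cl ss) \<le> c * real n ^ k"
      and success: "\<forall>X. X \<subseteq> {..<2^n} \<and> X \<noteq> {} \<longrightarrow> success_prob X d ss w0 ol \<ge> p"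
    for n d w0 ss ol
  proof -
    define L where "L = n div 2"
    have L: "L > 0" "real n \<le> 2 * real L + 1" using n by (auto simp: L_def)
    have "(real (num_cl ss) + 1) / 2 ^ L \<le> (c * real n ^ k + 1) / 2 ^ L"
      using cl by (intro divide_right_mono) auto
    also have "\<dots> \<le> \<mu> * p / 8" using n1[of n] n by (simp add: L_def)
    finally have "(real (num_cl ss) + 1) / 2 ^ L / \<mu> \<le> \<mu> * p / 8 / \<mu>"
      using \<mu> by (intro divide_right_mono) auto
    then have small: "(real (num_cl ss) + 1) / (2 ^ L * \<mu>) \<le> p / 8" using \<mu> by simp
    \<comment> \<open>From \<open>n \<ge> 18\<close> follows
      \<open>16 * n \<le> (n - 1) ^ 2\<close>; the point is to bound \<open>ln n\<close> by twice
      \<open>ln (L / 2)\<close>.\<close>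
    have "real n \<le> (real L / 2)\<^sup>2"
    proof -
      have "18 * real n \<le> real n * real n" using n by (intro mult_right_mono) auto
      then have "16 * real n \<le> (real n - 1)\<^sup>2" by (simp add: power2_eq_square algebra_simps)
      also have "\<dots> \<le> (2 * real L)\<^sup>2" using L n by (intro power_mono) auto
      finally show ?thesis by (simp add: power2_eq_square)
    qed
    then have "ln (real n) \<le> ln ((real L / 2)\<^sup>2)" using n by (intro ln_mono) auto
    then have ln: "ln (real n) \<le> 2 * ln (real L / 2)" using L by (simp add: ln_realpow)
    have W: "0 \<le> hilbert_weight L" unfolding hilbert_weight_def by (intro sum_nonneg) auto
    have "real L / 4 * ln (real n) * (p / 4) \<le> hilbert_weight L * (p / 4)"
    proof (rule mult_right_mono)
      have "real L / 4 * ln (real n) \<le> real L / 4 * (2 * ln (real L / 2))"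
        by (rule mult_left_mono[OF ln]) simp
      then show "real L / 4 * ln (real n) \<le> hilbert_weight L" using hilbert_weight_ge[of L] by simp
    qed (use assms in simp)
    also have "\<dots> \<le> hilbert_weight L * (p / 2 - 3 * \<mu> / 2 - (real (num_cl ss) + 1) / (2 ^ L * \<mu>))"
    proof (rule mult_left_mono[OF _ W])
      have "3 * \<mu> / 2 = p / 8" by (simp add: \<mu>_def)
      then show "p / 4 \<le> p / 2 - 3 * \<mu> / 2 - (real (num_cl ss) + 1) / (2 ^ L * \<mu>)"
        using small by linarith
    qed
    also have "\<dots> \<le> real (num_ex ss) * (192 * real L)"
      unfolding L_def using success by (intro num_ex_ge[OF ok \<open>w0 < d\<close> \<mu>]) auto
    \<comment> \<open>\<open>3072 = 4 * 4 * 192\<close>: from the weight bound, the remaining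
      \<open>p / 4\<close>, and the cost of an existential query.\<close>
    finally have "real L * (p / 3072 * ln (real n)) \<le> real L * real (num_ex ss)" by (simp add: mult_ac)
    then show ?thesis using L by simp
  qed
  show ?thesis
    using assms bound by (intro exI[of _ "p / 3072"] conjI exI[of _ "max n1 18"]) auto
qed

end
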